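(* Let $0<\epsilon<1$. Given an algorithm $A$ for the joint cache partition and job assignment problem that always returns a solution whose makespan is at most $1+\epsilon$ times the optimal makespan, one can construct (using $A$ as a subroutine) an algorithm for the ordered unrelated machines scheduling problem that returns a schedule of makespan at most $\left(1+2\epsilon+\frac{2\epsilon^2}{1-\epsilon-\chi}\right)$ times the optimal makespan, for any $\chi$ with $0<\chi<1-\epsilon$.
   Context: Ordered unrelated machines scheduling: $c$ machines $1,\dots,c$, $n$ jobs, running times $T(i,j)>0$ with $T(i_1,j)\ge T(i_2,j)$ whenever $i_1<i_2$; a schedule assigns each job to a machine and its makespan is the maximum over machines of the total running time of jobs assigned to it; the goal is to minimize the makespan. Joint cache partition and job assignment problem: given $c$ cores, total cache $K$ and a set $J$ of jobs, each job $j$ having a non-increasing load function $T_j(x)\in(0,\infty]$ of the cache $x$, a solution is a cache partition $p$ with $p(i)\ge0$, $\sum_{i=1}^c p(i)\le K$, and an assignment $S:J\to\{1,\dots,c\}$; its makespan is $\max_i\sum_{j:S(j)=i}T_j(p(i))$, to be minimized. *)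

theory Defs
  imports Complex_Main "HOL-Library.Extended_Real"
begin

section \<open>Ordered unrelated machines\<close>

record sched_instance =
  machines :: nat
  num_jobs :: nat
  runtime :: "nat \<Rightarrow> nat \<Rightarrow> real"

definition ordered_sched_instance :: "sched_instance \<Rightarrow> bool" where
  "ordered_sched_instance I \<longleftrightarrow>
     machines I \<ge> 1 \<and>
     (\<forall>i\<in>{1..machines I}. \<forall>j\<in>{1..num_jobs I}. runtime I i j > 0) \<and>
     (\<forall>i1\<in>{1..machines I}. \<forall>i2\<in>{1..machines I}. \<forall>j\<in>{1..num_jobs I}.
        i1 < i2 \<longrightarrow> runtime I i1 j \<ge> runtime I i2 j)"

definition is_schedule :: "sched_instance \<Rightarrow> (nat \<Rightarrow> nat) \<Rightarrow> bool" where
  "is_schedule I S \<longleftrightarrow> (\<forall>j\<in>{1..num_jobs I}. S j \<in> {1..machines I})"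

definition sched_makespan :: "sched_instance \<Rightarrow> (nat \<Rightarrow> nat) \<Rightarrow> real" where
  "sched_makespan I S =
     (MAX i\<in>{1..machines I}. \<Sum>j\<in>{j\<in>{1..num_jobs I}. S j = i}. runtime I i j)"

definition sched_opt :: "sched_instance \<Rightarrow> real" where
  "sched_opt I = (INF S\<in>{S. is_schedule I S}. sched_makespan I S)"

definition sched_approx_algorithm :: "real \<Rightarrow> (sched_instance \<Rightarrow> nat \<Rightarrow> nat) \<Rightarrow> bool" where
  "sched_approx_algorithm \<alpha> B \<longleftrightarrow>
     (\<forall>I. ordered_sched_instance I \<longrightarrow>
        is_schedule I (B I) \<and> sched_makespan I (B I) \<le> \<alpha> * sched_opt I)"


section \<open>Joint cache partition and job assignment\<close>

record joint_instance =
  cores :: nat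
  cache :: real
  jobs :: "nat set"
  load :: "nat \<Rightarrow> real \<Rightarrow> ereal"

definition valid_joint_instance :: "joint_instance \<Rightarrow> bool" where
  "valid_joint_instance Q \<longleftrightarrow>
     cores Q \<ge> 1 \<and> cache Q \<ge> 0 \<and> finite (jobs Q) \<and>
     (\<forall>j\<in>jobs Q. (\<forall>x\<ge>0. load Q j x > 0) \<and> (\<forall>x\<ge>0. \<forall>y\<ge>x. load Q j y \<le> load Q j x))"

type_synonym joint_solution = "(nat \<Rightarrow> real) \<times> (nat \<Rightarrow> nat)"

definition is_joint_solution :: "joint_instance \<Rightarrow> joint_solution \<Rightarrow> bool" where
  "is_joint_solution Q = (\<lambda>(p, S).
     (\<forall>i\<in>{1..cores Q}. p i \<ge> 0) \<and> (\<Sum>i\<in>{1..cores Q}. p i) \<le> cache Q \<and>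
     (\<forall>j\<in>jobs Q. S j \<in> {1..cores Q}))"

definition joint_makespan :: "joint_instance \<Rightarrow> joint_solution \<Rightarrow> ereal" where
  "joint_makespan Q = (\<lambda>(p, S).
     MAX i\<in>{1..cores Q}. \<Sum>j\<in>{j\<in>jobs Q. S j = i}. load Q j (p i))"

text \<open>For discontinuous load functions the minimum need not be attained, hence the infimum.\<close>

definition joint_opt :: "joint_instance \<Rightarrow> ereal" where
  "joint_opt Q = (INF \<sigma>\<in>{\<sigma>. is_joint_solution Q \<sigma>}. joint_makespan Q \<sigma>)"

definition joint_approx_algorithm :: "real \<Rightarrow> (joint_instance \<Rightarrow> joint_solution) \<Rightarrow> bool" where
  "joint_approx_algorithm \<alpha> A \<longleftrightarrow>
     (\<forall>Q. valid_joint_instance Q \<longrightarrow>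
        is_joint_solution Q (A Q) \<and> joint_makespan Q (A Q) \<le> ereal \<alpha> * joint_opt Q)"


section \<open>Programs with a subroutine for the joint problem\<close>

text \<open>
  An algorithm is a program for a unit-cost real RAM with a subroutine call. Memory consists of
  named arrays of naturals (one index) and of reals (two indices); scalars are stored at index 0.
  Naturals have no multiplication, so that \<open>t\<close> steps cannot produce numbers of more than
  \<open>O(t)\<close> bits. The only real constants in a program are naturals, so that no
  information about instances can be hidden in a program text. All loops are bounded,
  so every program terminates.
\<close>

datatype nexp =
    NConst nat
  | NGet string nexp
  | NAdd nexp nexp
  | NSub nexp nexp

datatype rexp =
    RConst nat
  | RGet string nexp nexp
  | RAdd rexp rexp
  | RSub rexp rexp
  | RMul rexp rexp
  | RDiv rexp rexp

datatype bexp =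
    NLess nexp nexp
  | RLess rexp rexp

datatype prog =
    Skip
  | NSet string nexp nexp
  | RSet string nexp nexp rexp
  | Seq prog prog
  | Cond bexp prog prog
  | For string nexp prog
  | Call nexp rexp nexp nexp

record store =
  nmem :: "string \<Rightarrow> nat \<Rightarrow> nat"
  rmem :: "string \<Rightarrow> nat \<Rightarrow> nat \<Rightarrow> real"
  steps :: nat

primrec nval :: "nexp \<Rightarrow> store \<Rightarrow> nat" where
  "nval (NConst k) s = k"
| "nval (NGet a e) s = nmem s a (nval e s)"
| "nval (NAdd e f) s = nval e s + nval f s"
| "nval (NSub e f) s = nval e s - nval f s"

primrec rval :: "rexp \<Rightarrow> store \<Rightarrow> real" where
  "rval (RConst k) s = real k"
| "rval (RGet a e f) s = rmem s a (nval e s) (nval f s)"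
| "rval (RAdd e f) s = rval e s + rval f s"
| "rval (RSub e f) s = rval e s - rval f s"
| "rval (RMul e f) s = rval e s * rval f s"
| "rval (RDiv e f) s = rval e s / rval f s"

primrec bval :: "bexp \<Rightarrow> store \<Rightarrow> bool" where
  "bval (NLess e f) s \<longleftrightarrow> nval e s < nval f s"
| "bval (RLess e f) s \<longleftrightarrow> rval e s < rval f s"

definition nset :: "string \<Rightarrow> nat \<Rightarrow> nat \<Rightarrow> store \<Rightarrow> store" where
  "nset a i v s = s\<lparr>nmem := (nmem s)(a := (nmem s a)(i := v))\<rparr>"

definition rset :: "string \<Rightarrow> nat \<Rightarrow> nat \<Rightarrow> real \<Rightarrow> store \<Rightarrow> store" where
  "rset a i k v s = s\<lparr>rmem := (rmem s)(a := (rmem s a)(i := (rmem s a i)(k := v)))\<rparr>"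

definition tick :: "nat \<Rightarrow> store \<Rightarrow> store" where
  "tick t s = s\<lparr>steps := steps s + t\<rparr>"

text \<open>
  A program passes a load function to the subroutine as a finite table: the \<open>k\<close>-th entry of job
  \<open>j\<close> says that with cache at least \<open>''thr'' j k\<close> the load is at most \<open>''val'' j k\<close>. The load is
  the least value applicable at \<open>x\<close>, and \<open>\<infinity>\<close> (the infimum of the empty set) if there is none; it
  is therefore non-increasing for every table.
\<close>

definition table_load :: "store \<Rightarrow> nat \<Rightarrow> nat \<Rightarrow> real \<Rightarrow> ereal" where
  "table_load s r j x = (INF k\<in>{k\<in>{1..r}. rmem s ''thr'' j k \<le> x}. ereal (rmem s ''val'' j k))"

definition table_instance :: "store \<Rightarrow> nat \<Rightarrow> real \<Rightarrow> nat \<Rightarrow> nat \<Rightarrow> joint_instance" where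
  "table_instance s c K m r =
     \<lparr>cores = c, cache = K, jobs = {1..m}, load = table_load s r\<rparr>"

definition call :: "(joint_instance \<Rightarrow> joint_solution) \<Rightarrow>
    nat \<Rightarrow> real \<Rightarrow> nat \<Rightarrow> nat \<Rightarrow> store \<Rightarrow> store" where
  "call A c K m r s =
     (let (p, S) = A (table_instance s c K m r) in
      s\<lparr>rmem := (rmem s)(''part'' := \<lambda>i k. if i \<in> {1..c} \<and> k = 0 then p i else 0),
        nmem := (nmem s)(''asg'' := \<lambda>j. if j \<in> {1..m} then S j else 0)\<rparr>)"

text \<open>
  Every command costs one step, plus one step per iteration for a loop, plus the size of the
  instance and its solution for a call. The bound of a loop is evaluated once, on entry.
\<close>

primrec exec :: "(joint_instance \<Rightarrow> joint_solution) \<Rightarrow> prog \<Rightarrow> store \<Rightarrow> store" where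
  "exec A Skip = tick 1"
| "exec A (NSet a e f) = (\<lambda>s. tick 1 (nset a (nval e s) (nval f s) s))"
| "exec A (RSet a e f g) = (\<lambda>s. tick 1 (rset a (nval e s) (nval f s) (rval g s) s))"
| "exec A (Seq P Q) = (\<lambda>s. exec A Q (exec A P (tick 1 s)))"
| "exec A (Cond b P Q) = (\<lambda>s. if bval b s then exec A P (tick 1 s) else exec A Q (tick 1 s))"
| "exec A (For a e P) =
     (\<lambda>s. fold (\<lambda>i s. exec A P (tick 1 (nset a 0 i s))) [1..<nval e s + 1] (tick 1 s))"
| "exec A (Call e g f h) =
     (\<lambda>s. let c = nval e s; m = nval f s; r = nval h s in
        tick (1 + c + m + m * r) (call A c (rval g s) m r s))"

definition initial_store :: "real \<Rightarrow> real \<Rightarrow> sched_instance \<Rightarrow> store" where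
  "initial_store \<epsilon> \<chi> I =
     \<lparr>nmem = (\<lambda>_ _. 0)
        (''c'' := (\<lambda>_. 0)(0 := machines I),
         ''n'' := (\<lambda>_. 0)(0 := num_jobs I)),
      rmem = (\<lambda>_ _ _. 0)
        (''T'' := \<lambda>i j. if i \<in> {1..machines I} \<and> j \<in> {1..num_jobs I} then runtime I i j else 0,
         ''eps'' := \<lambda>i k. if i = 0 \<and> k = 0 then \<epsilon> else 0,
         ''chi'' := \<lambda>i k. if i = 0 \<and> k = 0 then \<chi> else 0),
      steps = 0\<rparr>"

definition computed_schedule :: "prog \<Rightarrow> (joint_instance \<Rightarrow> joint_solution) \<Rightarrow> real \<Rightarrow> real \<Rightarrow>
    sched_instance \<Rightarrow> nat \<Rightarrow> nat" where
  "computed_schedule P A \<epsilon> \<chi> I = nmem (exec A P (initial_store \<epsilon> \<chi> I)) ''S''"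

text \<open>
  Only a bound on this number gives the subroutine a meaning: an unbounded program could ignore it
  and search through all schedules.
\<close>

definition running_time :: "prog \<Rightarrow> (joint_instance \<Rightarrow> joint_solution) \<Rightarrow> real \<Rightarrow> real \<Rightarrow>
    sched_instance \<Rightarrow> nat" where
  "running_time P A \<epsilon> \<chi> I = steps (exec A P (initial_store \<epsilon> \<chi> I))"

end

theory Submission
  imports Defs "HOL-Library.FuncSet"
begin

text \<open>
  Encode machine \<open>i\<close> as cache amount \<open>i\<close> and let \<open>1 + \<dots> + c\<close> be the total cache. For a guess
  \<open>D\<close>, add for every \<open>i\<close> a guard job whose load is \<open>D\<close> with cache at least \<open>i\<close> and \<open>\<infinity>\<close>
  below. The optimum is at most \<open>D + OPT\<close>. If \<open>(1 + \<epsilon>) (D + OPT) < 2 D\<close>, then the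
  approximate solution puts exactly one guard on every core; so the cores have exactly the caches
  \<open>1, \<dots>, c\<close>, the guards name the machines, and what remains on every core besides its
  guard is at most \<open>\<epsilon> D + (1 + \<epsilon>) OPT\<close>.

  The guess must lie between \<open>(1 + \<epsilon>) / (1 - \<epsilon>) OPT\<close> and
  \<open>(1 + \<epsilon> - \<chi>) / (1 - \<epsilon> - \<chi>) OPT\<close>, an interval of length at least \<open>OPT / N\<close> for a
  constant \<open>N\<close>. Let \<open>D\<close> grow from \<open>0\<close> in steps \<open>T(c, g) / N\<close>, cycling a constant number of
  times through all jobs \<open>g\<close>. Since \<open>T(c, g) \<le> OPT \<le> \<Sum>\<^sub>g T(c, g)\<close>, some step lands in the
  interval. The best schedule found is returned.
\<close>

section \<open>Program logic\<close>

lemma nmem_nset [simp]: "nmem (nset a i v s) = (nmem s)(a := (nmem s a)(i := v))"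
  and rmem_nset [simp]: "rmem (nset a i v s) = rmem s"
  and steps_nset [simp]: "steps (nset a i v s) = steps s"
  by (simp_all add: nset_def)

lemma nmem_rset [simp]: "nmem (rset a i k v s) = nmem s"
  and rmem_rset [simp]:
    "rmem (rset a i k v s) = (rmem s)(a := (rmem s a)(i := (rmem s a i)(k := v)))"
  and steps_rset [simp]: "steps (rset a i k v s) = steps s"
  by (simp_all add: rset_def)

lemma nmem_tick [simp]: "nmem (tick t s) = nmem s"
  and rmem_tick [simp]: "rmem (tick t s) = rmem s"
  and steps_tick [simp]: "steps (tick t s) = steps s + t"
  by (simp_all add: tick_def)

lemma nmem_call: "a \<noteq> ''asg'' \<Longrightarrow> nmem (call A c K m r s) a = nmem s a"
  and rmem_call: "a \<noteq> ''part'' \<Longrightarrow> rmem (call A c K m r s) a = rmem s a"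
  and nmem_call_asg: "nmem (call A c K m r s) ''asg'' =
    (\<lambda>j. if j \<in> {1..m} then snd (A (table_instance s c K m r)) j else 0)"
  and steps_call [simp]: "steps (call A c K m r s) = steps s"
  by (auto simp: call_def fun_eq_iff split: prod.split)

section \<open>Frames and loop invariants\<close>

primrec nwrites :: "prog \<Rightarrow> string set" where
  "nwrites Skip = {}"
| "nwrites (NSet a e f) = {a}"
| "nwrites (RSet a e f g) = {}"
| "nwrites (Seq P Q) = nwrites P \<union> nwrites Q"
| "nwrites (Cond b P Q) = nwrites P \<union> nwrites Q"
| "nwrites (For a e P) = insert a (nwrites P)"
| "nwrites (Call e g f h) = {''asg''}"

primrec rwrites :: "prog \<Rightarrow> string set" where
  "rwrites Skip = {}"
| "rwrites (NSet a e f) = {}"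
| "rwrites (RSet a e f g) = {a}"
| "rwrites (Seq P Q) = rwrites P \<union> rwrites Q"
| "rwrites (Cond b P Q) = rwrites P \<union> rwrites Q"
| "rwrites (For a e P) = rwrites P"
| "rwrites (Call e g f h) = {''part''}"

text \<open>The loop bound is evaluated once, on entry, so \<open>s\<close> fixes the number of
  iterations even if the body changes the variables of \<open>e\<close>.\<close>

lemma exec_For_induct:
  assumes "Inv 0 (tick 1 s)"
    and "\<And>i t. i < nval e s \<Longrightarrow> Inv i t \<Longrightarrow> Inv (Suc i) (exec A P (tick 1 (nset a 0 (Suc i) t)))"
  shows "Inv (nval e s) (exec A (For a e P) s)"
proof -
  have "Inv m (fold (\<lambda>i s. exec A P (tick 1 (nset a 0 i s))) [1..<m + 1] (tick 1 s))"
    if "m \<le> nval e s" for m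
    using that by (induction m) (use assms in auto)
  from this[of "nval e s"] show ?thesis by simp
qed

lemma nmem_exec: "b \<notin> nwrites P \<Longrightarrow> nmem (exec A P s) b = nmem s b"
proof (induction P arbitrary: s)
  case (For a e P)
  show ?case
    by (rule exec_For_induct[where Inv = "\<lambda>_ t. nmem t b = nmem s b"]) (use For in auto)
qed (auto simp: Let_def nmem_call)

lemma rmem_exec: "b \<notin> rwrites P \<Longrightarrow> rmem (exec A P s) b = rmem s b"
proof (induction P arbitrary: s)
  case (For a e P)
  show ?case
    by (rule exec_For_induct[where Inv = "\<lambda>_ t. rmem t b = rmem s b"]) (use For in auto)
qed (auto simp: Let_def rmem_call)

text \<open>The invariant is strengthened by the frame: arrays outside the write sets keep their
  values from loop entry, so that \<open>Inv\<close> only has to describe what the body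
  changes.\<close>

lemma exec_For_invariant:
  assumes "nval e s = m" and "Inv 0 (tick 1 s)"
    and "\<And>i t. i < m \<Longrightarrow> Inv i t \<Longrightarrow>
      (\<And>b. b \<notin> nwrites (For a e P) \<Longrightarrow> nmem t b = nmem s b) \<Longrightarrow>
      (\<And>b. b \<notin> rwrites P \<Longrightarrow> rmem t b = rmem s b) \<Longrightarrow>
      Inv (Suc i) (exec A P (tick 1 (nset a 0 (Suc i) t)))"
  shows "Inv m (exec A (For a e P) s)"
proof -
  let ?Inv = "\<lambda>i t. Inv i t \<and> (\<forall>b. b \<notin> nwrites (For a e P) \<longrightarrow> nmem t b = nmem s b) \<and>
    (\<forall>b. b \<notin> rwrites P \<longrightarrow> rmem t b = rmem s b)"
  have "?Inv (nval e s) (exec A (For a e P) s)"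
    by (rule exec_For_induct[where Inv = ?Inv]) (use assms in \<open>auto simp: nmem_exec rmem_exec\<close>)
  with assms(1) show ?thesis by simp
qed

section \<open>Polynomial running time\<close>

text \<open>One number is both coefficient and exponent, as in the final running time bound. The
  base is at least 1, so exponents can be raised freely.\<close>

definition poly_bounded :: "(nat \<Rightarrow> nat) \<Rightarrow> bool" where
  "poly_bounded f \<longleftrightarrow> (\<exists>d. \<forall>x. f x \<le> d * (x + 1) ^ d)"

lemma poly_bounded_const: "poly_bounded (\<lambda>_. k)"
  unfolding poly_bounded_def by (rule exI[of _ k]) simp

lemma poly_bounded_id: "poly_bounded (\<lambda>x. x)"
  unfolding poly_bounded_def by (rule exI[of _ 1]) simp

lemma poly_bounded_add:
  assumes "poly_bounded f" "poly_bounded g"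
  shows "poly_bounded (\<lambda>x. f x + g x)"
proof -
  from assms obtain d e where *: "\<And>x. f x \<le> d * (x + 1) ^ d" "\<And>x. g x \<le> e * (x + 1) ^ e"
    unfolding poly_bounded_def by blast
  have "f x + g x \<le> (d + e) * (x + 1) ^ (d + e)" for x
  proof -
    have "d * (x + 1) ^ d \<le> d * (x + 1) ^ (d + e)" "e * (x + 1) ^ e \<le> e * (x + 1) ^ (d + e)"
      by (intro mult_le_mono power_increasing; simp)+
    with *[of x] show ?thesis unfolding add_mult_distrib by linarith
  qed
  then show ?thesis unfolding poly_bounded_def by blast
qed

lemma poly_bounded_mult:
  assumes "poly_bounded f" "poly_bounded g"
  shows "poly_bounded (\<lambda>x. f x * g x)"
proof -
  from assms obtain d e where *: "\<And>x. f x \<le> d * (x + 1) ^ d" "\<And>x. g x \<le> e * (x + 1) ^ e"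
    unfolding poly_bounded_def by blast
  \<comment> \<open>The number has to dominate both the coefficient \<open>d * e\<close> and the
    exponent \<open>d + e\<close> of the product.\<close>
  have "f x * g x \<le> (d * e + d + e) * (x + 1) ^ (d * e + d + e)" for x
  proof -
    have "f x * g x \<le> (d * (x + 1) ^ d) * (e * (x + 1) ^ e)"
      using * by (intro mult_le_mono)
    also have "\<dots> = (d * e) * (x + 1) ^ (d + e)" by (simp add: power_add)
    also have "\<dots> \<le> (d * e + d + e) * (x + 1) ^ (d * e + d + e)"
      by (intro mult_le_mono power_increasing) auto
    finally show ?thesis .
  qed
  then show ?thesis unfolding poly_bounded_def by blast
qed

lemmas poly_bounded_intros =
  poly_bounded_const poly_bounded_id poly_bounded_add poly_bounded_mult

section \<open>A syntactic criterion for polynomial running time\<close>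

abbreviation scalar :: "string \<Rightarrow> nexp" where
  "scalar a \<equiv> NGet a (NConst 0)"

abbreviation input_size :: "store \<Rightarrow> nat" where
  "input_size s \<equiv> nmem s ''c'' 0 + nmem s ''n'' 0"

text \<open>Loop bounds and call sizes of this form cannot grow during execution as long as
  \<open>c\<close> and \<open>n\<close> are not overwritten.\<close>

fun size_exp :: "nexp \<Rightarrow> bool" where
  "size_exp (NConst k) = True"
| "size_exp (NGet a e) = (a \<in> {''c'', ''n''} \<and> e = NConst 0)"
| "size_exp (NAdd e f) = (size_exp e \<and> size_exp f)"
| "size_exp (NSub e f) = False"

primrec size_bounded :: "prog \<Rightarrow> bool" where
  "size_bounded Skip = True"
| "size_bounded (NSet a e f) = True"
| "size_bounded (RSet a e f g) = True"
| "size_bounded (Seq P Q) = (size_bounded P \<and> size_bounded Q)"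
| "size_bounded (Cond b P Q) = (size_bounded P \<and> size_bounded Q)"
| "size_bounded (For a e P) = (size_exp e \<and> size_bounded P)"
| "size_bounded (Call e g f h) = (size_exp e \<and> size_exp f \<and> size_exp h)"

lemma size_exp_poly:
  "size_exp e \<Longrightarrow> \<exists>f. poly_bounded f \<and> (\<forall>s. nval e s \<le> f (input_size s))"
proof (induction e)
  case (NConst k)
  show ?case by (intro exI[of _ "\<lambda>_. k"]) (simp add: poly_bounded_intros)
next
  case (NGet a e)
  then show ?case by (intro exI[of _ "\<lambda>x. x"]) (auto simp: poly_bounded_intros)
next
  case (NAdd e1 e2)
  then obtain f g where "poly_bounded f" "\<And>s. nval e1 s \<le> f (input_size s)"
    "poly_bounded g" "\<And>s. nval e2 s \<le> g (input_size s)" by auto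
  then show ?case
    by (intro exI[of _ "\<lambda>x. f x + g x"]) (auto intro: poly_bounded_intros add_mono)
qed simp

text \<open>Since \<open>c\<close> and \<open>n\<close> are never written, all intermediate stores
  have the same input size, and a loop pays the same bound for its body in every iteration. The
  bound is chosen before \<open>A\<close>, so it serves all subroutines at once.\<close>

lemma steps_poly:
  assumes "size_bounded P" "''c'' \<notin> nwrites P" "''n'' \<notin> nwrites P"
  shows "\<exists>f. poly_bounded f \<and> (\<forall>A s. steps (exec A P s) \<le> steps s + f (input_size s))"
  using assms
proof (induction P)
  case (Seq P Q)
  then obtain f g where fg: "poly_bounded f" "\<And>A s. steps (exec A P s) \<le> steps s + f (input_size s)"
    "poly_bounded g" "\<And>A s. steps (exec A Q s) \<le> steps s + g (input_size s)" by auto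
  have "steps (exec A (Seq P Q) s) \<le> steps s + (1 + f (input_size s) + g (input_size s))" for A s
    using fg(2)[of A "tick 1 s"] fg(4)[of A "exec A P (tick 1 s)"] Seq.prems
    by (simp add: nmem_exec)
  with fg show ?case
    by (intro exI[of _ "\<lambda>x. 1 + f x + g x"] conjI poly_bounded_intros) auto
next
  case (Cond b P Q)
  then obtain f g where fg: "poly_bounded f" "\<And>A s. steps (exec A P s) \<le> steps s + f (input_size s)"
    "poly_bounded g" "\<And>A s. steps (exec A Q s) \<le> steps s + g (input_size s)" by auto
  have "steps (exec A (Cond b P Q) s) \<le> steps s + (1 + f (input_size s) + g (input_size s))" for A s
    using fg(2)[of A "tick 1 s"] fg(4)[of A "tick 1 s"] by simp
  with fg show ?case
    by (intro exI[of _ "\<lambda>x. 1 + f x + g x"] conjI poly_bounded_intros) auto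
next
  case (For a e P)
  then obtain f where f: "poly_bounded f"
    "\<And>A s. steps (exec A P s) \<le> steps s + f (input_size s)" by auto
  from For.prems size_exp_poly obtain g where g: "poly_bounded g"
    "\<And>s. nval e s \<le> g (input_size s)" by auto
  have "steps (exec A (For a e P) s) \<le>
      steps s + (1 + g (input_size s) * (1 + f (input_size s)))" for A s
  proof -
    have "steps (exec A (For a e P) s) \<le> steps s + 1 + nval e s * (1 + f (input_size s))"
    proof (rule exec_For_invariant[where Inv =
          "\<lambda>i t. steps t \<le> steps s + 1 + i * (1 + f (input_size s))", OF refl], goal_cases)
      case (2 i t)
      have "input_size t = input_size s" using 2(3) For.prems by auto
      with 2(2) f(2)[of A "tick 1 (nset a 0 (Suc i) t)"] For.prems show ?case
        by (auto simp: algebra_simps)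
    qed simp
    also have "\<dots> \<le> steps s + 1 + g (input_size s) * (1 + f (input_size s))"
      by (intro add_left_mono mult_right_mono g) simp
    finally show ?thesis by simp
  qed
  with f g show ?case
    by (intro exI[of _ "\<lambda>x. 1 + g x * (1 + f x)"] conjI poly_bounded_intros) auto
next
  case (Call e g f h)
  then obtain p q r where *: "poly_bounded p" "\<And>s. nval e s \<le> p (input_size s)"
      "poly_bounded q" "\<And>s. nval f s \<le> q (input_size s)"
      "poly_bounded r" "\<And>s. nval h s \<le> r (input_size s)"
    using size_exp_poly by (metis size_bounded.simps(7))
  then show ?case
    by (intro exI[of _ "\<lambda>x. 1 + p x + q x + q x * r x"] conjI poly_bounded_intros)
      (auto simp: Let_def intro!: add_mono mult_mono)
qed (auto intro!: exI[of _ "\<lambda>_. 1"] simp: poly_bounded_intros)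

lemma running_time_poly:
  assumes "size_bounded P" "''c'' \<notin> nwrites P" "''n'' \<notin> nwrites P"
  shows "\<exists>d. \<forall>A \<epsilon> \<chi> I. running_time P A \<epsilon> \<chi> I \<le> d * (machines I + num_jobs I + 1) ^ d"
proof -
  from steps_poly[OF assms] obtain f where f: "poly_bounded f"
    "\<And>A s. steps (exec A P s) \<le> steps s + f (input_size s)" by blast
  from f(1) obtain d where d: "\<And>x. f x \<le> d * (x + 1) ^ d" unfolding poly_bounded_def by blast
  have "running_time P A \<epsilon> \<chi> I \<le> f (machines I + num_jobs I)" for A \<epsilon> \<chi> I
    using f(2)[of A "initial_store \<epsilon> \<chi> I"]
    by (simp add: running_time_def initial_store_def)
  with d show ?thesis by (meson le_trans)
qed

section \<open>Schedules\<close>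

lemma machine_load_le_makespan:
  assumes "i \<in> {1..machines I}"
  shows "(\<Sum>j\<in>{j\<in>{1..num_jobs I}. S j = i}. runtime I i j) \<le> sched_makespan I S"
  unfolding sched_makespan_def using assms by (intro Max_ge) auto

lemma sched_makespan_le:
  assumes "machines I \<ge> 1"
    and "\<And>i. i \<in> {1..machines I} \<Longrightarrow> (\<Sum>j\<in>{j\<in>{1..num_jobs I}. S j = i}. runtime I i j) \<le> v"
  shows "sched_makespan I S \<le> v"
  unfolding sched_makespan_def using assms by (subst Max_le_iff) auto

lemma sched_makespan_cong:
  assumes "\<And>j. j \<in> {1..num_jobs I} \<Longrightarrow> S j = S' j"
  shows "sched_makespan I S = sched_makespan I S'"
proof -
  have "{j \<in> {1..num_jobs I}. S j = i} = {j \<in> {1..num_jobs I}. S' j = i}" for i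
    using assms by auto
  then show ?thesis by (simp add: sched_makespan_def)
qed

text \<open>The infimum ranges over infinitely many functions, but their values outside the jobs do
  not affect the makespan. Hence only finitely many makespans occur and the infimum is a
  minimum.\<close>

lemma sched_opt_attained:
  assumes "machines I \<ge> 1"
  obtains S where "is_schedule I S" "sched_makespan I S = sched_opt I"
    and "\<And>S'. is_schedule I S' \<Longrightarrow> sched_opt I \<le> sched_makespan I S'"
proof -
  let ?V = "sched_makespan I ` {S. is_schedule I S}"
  have "?V \<subseteq> sched_makespan I ` ({1..num_jobs I} \<rightarrow>\<^sub>E {1..machines I})"
  proof
    fix v assume "v \<in> ?V"
    then obtain S where S: "is_schedule I S" "v = sched_makespan I S" by auto
    have "v = sched_makespan I (restrict S {1..num_jobs I})"
      unfolding S by (rule sched_makespan_cong) simp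
    moreover have "restrict S {1..num_jobs I} \<in> {1..num_jobs I} \<rightarrow>\<^sub>E {1..machines I}"
      using S(1) by (auto simp: is_schedule_def)
    ultimately show "v \<in> sched_makespan I ` ({1..num_jobs I} \<rightarrow>\<^sub>E {1..machines I})" by blast
  qed
  then have fin: "finite ?V" by (rule finite_subset) (intro finite_imageI finite_PiE; simp)
  have "is_schedule I (\<lambda>_. 1)" using assms by (simp add: is_schedule_def)
  then have ne: "?V \<noteq> {}" by blast
  have eq: "sched_opt I = Min ?V" using fin ne by (simp add: sched_opt_def cInf_eq_Min)
  from Min_in[OF fin ne] obtain S where "is_schedule I S" "sched_makespan I S = Min ?V" by force
  moreover have "Min ?V \<le> sched_makespan I S'" if "is_schedule I S'" for S'
    using fin that by (intro Min_le) auto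
  ultimately show ?thesis using that eq by metis
qed

section \<open>Bounds on the makespan in an ordered instance\<close>

context
  fixes I :: sched_instance
  assumes ordered: "ordered_sched_instance I"
begin

lemma machines_ge_1: "machines I \<ge> 1"
  using ordered by (simp add: ordered_sched_instance_def)

lemma runtime_pos:
  "i \<in> {1..machines I} \<Longrightarrow> j \<in> {1..num_jobs I} \<Longrightarrow> 0 < runtime I i j"
  using ordered by (simp add: ordered_sched_instance_def)

lemma runtime_antimono:
  assumes "i \<in> {1..machines I}" "i' \<in> {1..machines I}" "j \<in> {1..num_jobs I}" "i \<le> i'"
  shows "runtime I i' j \<le> runtime I i j"
  using ordered assms by (cases "i = i'") (auto simp: ordered_sched_instance_def)

lemma sched_makespan_nonneg: "0 \<le> sched_makespan I S"
proof -
  have "0 \<le> (\<Sum>j\<in>{j\<in>{1..num_jobs I}. S j = 1}. runtime I 1 j)"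
    using runtime_pos machines_ge_1 by (intro sum_nonneg) (simp add: less_imp_le)
  also have "\<dots> \<le> sched_makespan I S"
    using machines_ge_1 by (intro machine_load_le_makespan) simp
  finally show ?thesis .
qed

lemma sched_makespan_no_jobs: "num_jobs I = 0 \<Longrightarrow> sched_makespan I S = 0"
  using sched_makespan_le[of I S 0] sched_makespan_nonneg[of S] machines_ge_1 by simp

text \<open>The last machine is the fastest for every job. Applied to an optimal schedule, this
  bounds every increment of the guess by a fraction of the optimum.\<close>

lemma fastest_runtime_le_makespan:
  assumes "is_schedule I S" "j \<in> {1..num_jobs I}"
  shows "runtime I (machines I) j \<le> sched_makespan I S"
proof -
  have S: "S j \<in> {1..machines I}" using assms by (simp add: is_schedule_def)
  have "runtime I (machines I) j \<le> runtime I (S j) j"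
    using S assms(2) machines_ge_1 by (intro runtime_antimono) auto
  also have "\<dots> \<le> (\<Sum>j'\<in>{j'\<in>{1..num_jobs I}. S j' = S j}. runtime I (S j) j')"
    using runtime_pos S assms(2) by (intro member_le_sum) (auto simp: less_imp_le)
  also have "\<dots> \<le> sched_makespan I S" by (rule machine_load_le_makespan[OF S])
  finally show ?thesis .
qed

text \<open>The sum bounds the optimum from above, so a fixed number of passes over all jobs raises
  the guess beyond any given multiple of the optimum.\<close>

lemma sched_makespan_fastest:
  assumes "\<And>j. j \<in> {1..num_jobs I} \<Longrightarrow> S j = machines I"
  shows "sched_makespan I S \<le> (\<Sum>j\<in>{1..num_jobs I}. runtime I (machines I) j)"
proof (rule sched_makespan_le[OF machines_ge_1])
  fix i assume i: "i \<in> {1..machines I}"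
  show "(\<Sum>j\<in>{j\<in>{1..num_jobs I}. S j = i}. runtime I i j)
      \<le> (\<Sum>j\<in>{1..num_jobs I}. runtime I (machines I) j)"
  proof (cases "i = machines I")
    case True
    then show ?thesis using assms by (intro eq_refl sum.cong) auto
  next
    case False
    then have "{j\<in>{1..num_jobs I}. S j = i} = {}" using assms by auto
    moreover have "0 \<le> (\<Sum>j\<in>{1..num_jobs I}. runtime I (machines I) j)"
      using runtime_pos machines_ge_1 by (intro sum_nonneg) (simp add: less_imp_le)
    ultimately show ?thesis by (simp only: sum.empty)
  qed
qed

end

section \<open>The joint instance of a guess\<close>

definition guard_cache :: "sched_instance \<Rightarrow> real" where
  "guard_cache I = (\<Sum>i\<in>{1..machines I}. real i)"

text \<open>
  Core \<open>i\<close> is meant to get cache \<open>i\<close>. Jobs \<open>1, \<dots>, c\<close> are guards that tie the cores to these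
  amounts: guard \<open>i\<close> needs cache \<open>i\<close> and then has load \<open>D\<close>. Job \<open>c + j\<close> stands for job \<open>j\<close>.
\<close>

definition encodes :: "sched_instance \<Rightarrow> real \<Rightarrow> store \<Rightarrow> bool" where
  "encodes I D s \<longleftrightarrow>
     (\<forall>i\<in>{1..machines I}. \<forall>k\<in>{1..machines I}.
        rmem s ''thr'' i k = real i \<and> rmem s ''val'' i k = D) \<and>
     (\<forall>j\<in>{1..num_jobs I}. \<forall>k\<in>{1..machines I}.
        rmem s ''thr'' (machines I + j) k = real k \<and>
        rmem s ''val'' (machines I + j) k = runtime I k j)"

abbreviation guess_instance :: "sched_instance \<Rightarrow> store \<Rightarrow> joint_instance" where
  "guess_instance I s \<equiv>
     table_instance s (machines I) (guard_cache I) (machines I + num_jobs I) (machines I)"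

text \<open>Only finitely many entries apply, so a nonempty infimum is attained at a positive entry;
  the empty one is \<infinity>.\<close>

lemma table_load_pos:
  assumes "\<And>k. k \<in> {1..r} \<Longrightarrow> 0 < rmem s ''val'' j k"
  shows "0 < table_load s r j x"
proof (cases "{k\<in>{1..r}. rmem s ''thr'' j k \<le> x} = {}")
  case True
  then show ?thesis by (simp add: table_load_def top_ereal_def del: Collect_empty_eq)
next
  case False
  then have "table_load s r j x \<in> (\<lambda>k. ereal (rmem s ''val'' j k)) ` {k\<in>{1..r}. rmem s ''thr'' j k \<le> x}"
    unfolding table_load_def by (subst cInf_eq_Min) (auto intro!: Min_in simp del: Collect_empty_eq)
  then show ?thesis using assms by auto
qed

lemma table_load_antimono: "x \<le> y \<Longrightarrow> table_load s r j y \<le> table_load s r j x"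
  unfolding table_load_def by (intro INF_superset_mono) auto

context
  fixes I :: sched_instance
  assumes ordered: "ordered_sched_instance I"
begin

text \<open>All entries of a guard row share one threshold, so either all of them apply or none
  does.\<close>

lemma guard_load:
  assumes "encodes I D s" "i \<in> {1..machines I}"
  shows "table_load s (machines I) i x = (if real i \<le> x then ereal D else \<infinity>)"
proof (cases "real i \<le> x")
  case True
  have "table_load s (machines I) i x = (INF k\<in>{1..machines I}. ereal D)"
    unfolding table_load_def using assms True by (intro INF_cong) (auto simp: encodes_def)
  then show ?thesis using True machines_ge_1[OF ordered] by simp
next
  case False
  then have "{k\<in>{1..machines I}. rmem s ''thr'' i k \<le> x} = {}"
    using assms by (auto simp: encodes_def)
  then show ?thesis using False by (simp add: table_load_def top_ereal_def del: Collect_empty_eq)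
qed

text \<open>Exactly the entries \<open>1\<close> to \<open>i\<close> apply, and the last of them is
  the least because the machines are ordered.\<close>

lemma job_load:
  assumes "encodes I D s" "j \<in> {1..num_jobs I}" "i \<in> {1..machines I}"
  shows "table_load s (machines I) (machines I + j) (real i) = ereal (runtime I i j)"
proof -
  have "table_load s (machines I) (machines I + j) (real i) =
      (INF k\<in>{1..i}. ereal (runtime I k j))"
    unfolding table_load_def using assms by (intro INF_cong) (auto simp: encodes_def)
  also have "\<dots> = ereal (runtime I i j)"
    using assms by (intro antisym INF_lower2[of i] INF_greatest) (auto intro!: runtime_antimono[OF ordered])
  finally show ?thesis .
qed

lemma guard_or_job:
  assumes "j \<in> {1..machines I + num_jobs I}"
  obtains (guard) "j \<in> {1..machines I}"
    | (job) j' where "j' \<in> {1..num_jobs I}" "j = machines I + j'"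
proof (cases "j \<le> machines I")
  case False
  with assms have "j - machines I \<in> {1..num_jobs I}" "j = machines I + (j - machines I)" by auto
  then show ?thesis by (rule job)
qed (use assms guard in auto)

lemma encoded_load_pos:
  assumes "encodes I D s" "0 < D" "j \<in> {1..machines I + num_jobs I}"
  shows "0 < table_load s (machines I) j x"
  using assms(3)
proof (cases rule: guard_or_job)
  case guard
  with assms show ?thesis by (intro table_load_pos) (auto simp: encodes_def)
next
  case (job j')
  with assms runtime_pos[OF ordered] show ?thesis by (intro table_load_pos) (auto simp: encodes_def)
qed

lemma valid_guess_instance:
  assumes "encodes I D s" "0 < D"
  shows "valid_joint_instance (guess_instance I s)"
  using encoded_load_pos[OF assms] machines_ge_1[OF ordered] table_load_antimono
  by (auto simp: valid_joint_instance_def table_instance_def guard_cache_def sum_nonneg)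

text \<open>Core \<open>i\<close> gets cache \<open>i\<close>, guard \<open>i\<close> and the jobs
  that \<open>S\<close> puts on machine \<open>i\<close>. This uses up the cache exactly and adds
  just \<open>D\<close> to every machine load.\<close>

lemma joint_opt_guess_le:
  assumes "encodes I D s" "is_schedule I S"
  shows "joint_opt (guess_instance I s) \<le> ereal (D + sched_makespan I S)"
proof -
  let ?c = "machines I" and ?n = "num_jobs I"
  define \<sigma> where "\<sigma> j = (if j \<le> ?c then j else S (j - ?c))" for j
  have sol: "is_joint_solution (guess_instance I s) (real, \<sigma>)"
  proof -
    have "\<sigma> j \<in> {1..?c}" if "j \<in> {1..?c + ?n}" for j
      using that assms(2) by (cases rule: guard_or_job) (auto simp: \<sigma>_def is_schedule_def)
    then show ?thesis
      by (simp add: is_joint_solution_def table_instance_def guard_cache_def)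
  qed
  have "joint_makespan (guess_instance I s) (real, \<sigma>) \<le> ereal (D + sched_makespan I S)"
  proof -
    have "(\<Sum>j\<in>{j\<in>{1..?c + ?n}. \<sigma> j = i}. table_load s ?c j (real i)) \<le>
        ereal (D + sched_makespan I S)" if i: "i \<in> {1..?c}" for i
    proof -
      have "j \<in> insert i ((+) ?c ` {j\<in>{1..?n}. S j = i})"
        if "j \<in> {1..?c + ?n}" "\<sigma> j = i" for j
        using that by (cases rule: guard_or_job) (auto simp: \<sigma>_def)
      moreover have "insert i ((+) ?c ` {j\<in>{1..?n}. S j = i}) \<subseteq> {j\<in>{1..?c + ?n}. \<sigma> j = i}"
        using i by (auto simp: \<sigma>_def)
      ultimately have "{j\<in>{1..?c + ?n}. \<sigma> j = i} = insert i ((+) ?c ` {j\<in>{1..?n}. S j = i})"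
        by blast
      moreover have "i \<notin> (+) ?c ` {j\<in>{1..?n}. S j = i}" using i by auto
      ultimately have "(\<Sum>j\<in>{j\<in>{1..?c + ?n}. \<sigma> j = i}. table_load s ?c j (real i)) =
          table_load s ?c i (real i) +
          (\<Sum>j\<in>{j\<in>{1..?n}. S j = i}. table_load s ?c (?c + j) (real i))"
        by (simp add: sum.reindex)
      also have "\<dots> = ereal (D + (\<Sum>j\<in>{j\<in>{1..?n}. S j = i}. runtime I i j))"
        using assms(1) i by (simp add: guard_load job_load flip: plus_ereal.simps(1))
      also have "\<dots> \<le> ereal (D + sched_makespan I S)"
        using machine_load_le_makespan[OF i] by simp
      finally show ?thesis .
    qed
    then show ?thesis
      using machines_ge_1[OF ordered] by (auto simp: joint_makespan_def table_instance_def)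
  qed
  moreover have "joint_opt (guess_instance I s) \<le> joint_makespan (guess_instance I s) (real, \<sigma>)"
    unfolding joint_opt_def using sol by (intro INF_lower) simp
  ultimately show ?thesis by (rule order_trans[rotated])
qed

text \<open>A finite makespan forces guard \<open>i\<close> onto a core with cache at least
  \<open>i\<close>, and two guards on one core would already cost \<open>2 * D\<close>. Hence the
  guards permute the cores and use up the cache, and each core carries one guard besides the running
  times of its machine. The condition on \<open>S\<close> sends each job to the machine whose guard
  shares its core.\<close>

lemma guess_solution:
  assumes enc: "encodes I D s" and "0 < D"
    and sol: "is_joint_solution (guess_instance I s) (p, \<sigma>)"
    and le: "joint_makespan (guess_instance I s) (p, \<sigma>) \<le> ereal v" and "v < 2 * D"
  shows "inj_on \<sigma> {1..machines I}"
    and "\<And>S. (\<And>j i. j \<in> {1..num_jobs I} \<Longrightarrow> i \<in> {1..machines I} \<Longrightarrow>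
      \<sigma> (machines I + j) = \<sigma> i \<Longrightarrow> S j = i) \<Longrightarrow> sched_makespan I S \<le> v - D"
proof -
  let ?c = "machines I" and ?n = "num_jobs I"
  let ?L = "table_load s ?c"
  let ?J = "\<lambda>q. {j\<in>{1..?c + ?n}. \<sigma> j = q}"
  have \<sigma>: "\<sigma> j \<in> {1..?c}" if "j \<in> {1..?c + ?n}" for j
    using sol that by (simp add: is_joint_solution_def table_instance_def)
  \<comment> \<open>Loads are positive, so any selection of the jobs on a core costs at most the
    makespan.\<close>
  have core: "(\<Sum>j\<in>B. ?L j (p q)) \<le> ereal v" if "q \<in> {1..?c}" "B \<subseteq> ?J q" for q B
  proof -
    have "(\<Sum>j\<in>B. ?L j (p q)) \<le> (\<Sum>j\<in>?J q. ?L j (p q))"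
      using that(2) encoded_load_pos[OF enc \<open>0 < D\<close>] by (intro sum_mono2) (auto intro!: less_imp_le)
    also have "\<dots> \<le> joint_makespan (guess_instance I s) (p, \<sigma>)"
      using that(1) by (auto simp: joint_makespan_def table_instance_def intro!: Max_ge)
    finally show ?thesis using le by simp
  qed
  have guard: "real i \<le> p (\<sigma> i)" if i: "i \<in> {1..?c}" for i
    using core[of "\<sigma> i" "{i}"] \<sigma>[of i] i by (auto simp: guard_load[OF enc i] split: if_splits)
  show inj: "inj_on \<sigma> {1..?c}"
  proof (rule inj_onI, rule ccontr)
    fix i i' assume *: "i \<in> {1..?c}" "i' \<in> {1..?c}" "\<sigma> i = \<sigma> i'" "i \<noteq> i'"
    have "(\<Sum>j\<in>{i, i'}. ?L j (p (\<sigma> i))) \<le> ereal v" using * \<sigma>[of i] by (intro core) auto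
    moreover have "(\<Sum>j\<in>{i, i'}. ?L j (p (\<sigma> i))) = ereal (D + D)"
      using * guard[of i] guard[of i'] by (simp add: guard_load[OF enc])
    ultimately show False using \<open>v < 2 * D\<close> by simp
  qed
  \<comment> \<open>An injective map of a finite set into itself is onto: every core has a
    guard.\<close>
  have perm: "\<sigma> ` {1..?c} = {1..?c}"
    by (intro card_subset_eq card_image inj) (use \<sigma> in auto)
  have "(\<Sum>i\<in>{1..?c}. p (\<sigma> i)) = (\<Sum>q\<in>{1..?c}. p q)"
    using sum.reindex[OF inj, of p] perm by simp
  also have "\<dots> \<le> (\<Sum>i\<in>{1..?c}. real i)"
    using sol by (simp add: is_joint_solution_def table_instance_def guard_cache_def)
  finally have sum_le: "(\<Sum>i\<in>{1..?c}. p (\<sigma> i)) \<le> (\<Sum>i\<in>{1..?c}. real i)" .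
  \<comment> \<open>If one core had more cache than its guard needs, the total would exceed what is
    available.\<close>
  have exact: "p (\<sigma> i) = real i" if "i \<in> {1..?c}" for i
  proof (rule ccontr)
    assume "p (\<sigma> i) \<noteq> real i"
    with guard that have "(\<Sum>i\<in>{1..?c}. real i) < (\<Sum>i\<in>{1..?c}. p (\<sigma> i))"
      by (intro sum_strict_mono_ex1) (use that in \<open>auto intro!: bexI[of _ i] simp: less_le\<close>)
    with sum_le show False by simp
  qed
  show "sched_makespan I S \<le> v - D"
    if S: "\<And>j i. j \<in> {1..?n} \<Longrightarrow> i \<in> {1..?c} \<Longrightarrow> \<sigma> (?c + j) = \<sigma> i \<Longrightarrow> S j = i" for S
  proof (rule sched_makespan_le[OF machines_ge_1[OF ordered]])
    fix i assume i: "i \<in> {1..?c}"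
    let ?B = "{j\<in>{1..?n}. S j = i}"
    \<comment> \<open>The core of job \<open>j\<close> has some guard \<open>i'\<close>; the
      condition on \<open>S\<close> gives \<open>S j = i'\<close>, so \<open>i' = i\<close>.\<close>
    have "\<sigma> (?c + j) = \<sigma> i" if j: "j \<in> ?B" for j
    proof -
      have "\<sigma> (?c + j) \<in> \<sigma> ` {1..?c}" unfolding perm using j by (intro \<sigma>) auto
      then obtain i' where "i' \<in> {1..?c}" "\<sigma> (?c + j) = \<sigma> i'" by blast
      with S[of j i'] j show ?thesis by auto
    qed
    then have "(\<Sum>j\<in>insert i ((+) ?c ` ?B). ?L j (p (\<sigma> i))) \<le> ereal v"
      using i \<sigma>[of i] by (intro core) auto
    moreover have "(\<Sum>j\<in>insert i ((+) ?c ` ?B). ?L j (p (\<sigma> i))) =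
        ?L i (p (\<sigma> i)) + (\<Sum>j\<in>(+) ?c ` ?B. ?L j (p (\<sigma> i)))"
      using i by (subst sum.insert) auto
    moreover have "(\<Sum>j\<in>(+) ?c ` ?B. ?L j (p (\<sigma> i))) = (\<Sum>j\<in>?B. ?L (?c + j) (real i))"
      using exact[OF i] by (subst sum.reindex) auto
    moreover have "(\<Sum>j\<in>?B. ?L (?c + j) (real i)) = ereal (\<Sum>j\<in>?B. runtime I i j)"
      using job_load[OF enc _ i] by simp
    ultimately show "(\<Sum>j\<in>?B. runtime I i j) \<le> v - D"
      by (simp add: guard_load[OF enc i] exact[OF i])
  qed
qed

end

section \<open>The program\<close>

abbreviation (input) "rscalar a \<equiv> RGet a (NConst 0) (NConst 0)"
abbreviation (input) "cN \<equiv> scalar ''c''"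
abbreviation (input) "nN \<equiv> scalar ''n''"
abbreviation (input) "iN \<equiv> scalar ''i''"
abbreviation (input) "jN \<equiv> scalar ''j''"
abbreviation (input) "kN \<equiv> scalar ''k''"
abbreviation (input) "set_rscalar a \<equiv> RSet a (NConst 0) (NConst 0)"

text \<open>
  Row and column \<open>0\<close> of \<open>''thr''\<close> stay \<open>0\<close>; the programs compute real thresholds by counting from
  there, as there is no conversion from naturals to reals.
\<close>

definition guard_row :: prog where
  "guard_row =
     For ''k'' cN
       (RSet ''thr'' iN kN (RAdd (RGet ''thr'' (NSub iN (NConst 1)) kN) (RConst 1)))"

text \<open>The diagonal entry of row \<open>i\<close> of \<open>thr\<close> is the real number
  \<open>i\<close>, so \<open>K\<close> accumulates the total cache.\<close>

definition guards_setup :: prog where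
  "guards_setup =
     For ''i'' cN
       (Seq guard_row
       (Seq (set_rscalar ''K'' (RAdd (rscalar ''K'') (RGet ''thr'' iN iN)))
            (NSet ''core'' iN cN)))"

definition job_row :: prog where
  "job_row =
     For ''k'' cN
       (Seq (RSet ''thr'' (NAdd cN jN) kN
              (RAdd (RGet ''thr'' (NAdd cN jN) (NSub kN (NConst 1))) (RConst 1)))
            (RSet ''val'' (NAdd cN jN) kN (RGet ''T'' kN jN)))"

text \<open>The search starts from the schedule that runs all jobs on the fastest machine.\<close>

definition jobs_setup :: prog where
  "jobs_setup =
     For ''j'' nN
       (Seq job_row
       (Seq (NSet ''S'' jN cN)
            (set_rscalar ''best'' (RAdd (rscalar ''best'') (RGet ''T'' cN jN)))))"

definition guess_row :: prog where
  "guess_row = For ''k'' cN (RSet ''val'' iN kN (rscalar ''D''))"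

text \<open>Only the values of the guards depend on the guess; thresholds and job rows survive from
  the setup.\<close>

definition guess_setup :: prog where
  "guess_setup = For ''i'' cN guess_row"

text \<open>
  \<open>''core''\<close> maps a core to the machine named by its guard. A core without a guard keeps its entry
  from an earlier round (initially \<open>c\<close>), so that every candidate is a schedule, if perhaps a bad one.
\<close>

definition match_cores :: prog where
  "match_cores =
     For ''i'' cN
       (Seq (NSet ''core'' (NGet ''asg'' iN) iN)
            (RSet ''load'' iN (NConst 0) (RConst 0)))"

definition evaluate :: prog where
  "evaluate =
     For ''j'' nN
       (Seq (NSet ''cand'' jN (NGet ''core'' (NGet ''asg'' (NAdd cN jN))))
       (Seq (RSet ''load'' (NGet ''cand'' jN) (NConst 0)
              (RAdd (RGet ''load'' (NGet ''cand'' jN) (NConst 0))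
                    (RGet ''T'' (NGet ''cand'' jN) jN)))
            (Cond (RLess (rscalar ''max'') (RGet ''load'' (NGet ''cand'' jN) (NConst 0)))
                  (set_rscalar ''max'' (RGet ''load'' (NGet ''cand'' jN) (NConst 0)))
                  Skip)))"

definition update :: prog where
  "update =
     Cond (RLess (rscalar ''max'') (rscalar ''best''))
       (Seq (set_rscalar ''best'' (rscalar ''max''))
            (For ''j'' nN (NSet ''S'' jN (NGet ''cand'' jN))))
       Skip"

text \<open>\<open>D\<close> is kept between guesses, so each run raises it by a fraction of the
  fastest running time of job \<open>g\<close>. The program divides by \<open>N\<close> itself
  because its real constants are naturals.\<close>

definition try_guess :: "nat \<Rightarrow> prog" where
  "try_guess N =
     Seq (set_rscalar ''D'' (RAdd (rscalar ''D'') (RDiv (RGet ''T'' cN (scalar ''g'')) (RConst N))))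
    (Seq guess_setup
    (Seq (Call cN (rscalar ''K'') (NAdd cN nN) cN)
    (Seq match_cores
    (Seq (set_rscalar ''max'' (RConst 0))
    (Seq evaluate update)))))"

text \<open>\<open>N\<close> and \<open>L\<close> will depend on \<epsilon> and \<chi> only, so the
  outer loop costs a constant factor and one program text serves all instances and
  subroutines.\<close>

definition scheduler :: "nat \<Rightarrow> nat \<Rightarrow> prog" where
  "scheduler N L =
     Seq guards_setup
    (Seq jobs_setup
         (For ''a'' (NConst L) (For ''g'' nN (try_guess N))))"

lemmas scheduler_defs = scheduler_def try_guess_def update_def evaluate_def match_cores_def
  guess_setup_def guess_row_def jobs_setup_def job_row_def guards_setup_def guard_row_def

section \<open>Correctness of the program\<close>

definition input :: "sched_instance \<Rightarrow> store \<Rightarrow> bool" where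
  "input I s \<longleftrightarrow> nmem s ''c'' 0 = machines I \<and> nmem s ''n'' 0 = num_jobs I \<and>
     (\<forall>i\<in>{1..machines I}. \<forall>j\<in>{1..num_jobs I}. rmem s ''T'' i j = runtime I i j)"

lemma input_cong:
  assumes "nmem t ''c'' = nmem s ''c''" "nmem t ''n'' = nmem s ''n''" "rmem t ''T'' = rmem s ''T''"
  shows "input I t \<longleftrightarrow> input I s"
  using assms by (simp add: input_def)

text \<open>The invariant between guesses: all that \<open>encodes\<close> demands is in place
  except the guard values, which every guess rewrites.\<close>

definition ready :: "sched_instance \<Rightarrow> store \<Rightarrow> bool" where
  "ready I s \<longleftrightarrow> input I s \<and>
     (\<forall>i\<in>{1..machines I}. \<forall>k\<in>{1..machines I}. rmem s ''thr'' i k = real i) \<and>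
     (\<forall>j\<in>{1..num_jobs I}. \<forall>k\<in>{1..machines I}.
        rmem s ''thr'' (machines I + j) k = real k \<and>
        rmem s ''val'' (machines I + j) k = runtime I k j) \<and>
     rmem s ''K'' 0 0 = guard_cache I \<and>
     (\<forall>q\<in>{1..machines I}. nmem s ''core'' q \<in> {1..machines I}) \<and>
     is_schedule I (nmem s ''S'') \<and> sched_makespan I (nmem s ''S'') \<le> rmem s ''best'' 0 0"

context
  fixes I :: sched_instance and A :: "joint_instance \<Rightarrow> joint_solution"
  assumes ordered: "ordered_sched_instance I"
begin

abbreviation (input) "c \<equiv> machines I"
abbreviation (input) "n \<equiv> num_jobs I"

text \<open>Row \<open>Suc i\<close> is row \<open>i\<close> plus one. Only columns from
  \<open>1\<close> on are written, so column \<open>0\<close> stays zero for the job rows.\<close>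

lemma guard_row:
  assumes "nmem s ''c'' 0 = c" "nmem s ''i'' 0 = Suc i"
    and "\<forall>k\<in>{1..c}. rmem s ''thr'' i k = real i" "\<forall>i. rmem s ''thr'' i 0 = 0"
  defines "s' \<equiv> exec A guard_row s"
  shows "\<forall>i'\<noteq>Suc i. rmem s' ''thr'' i' = rmem s ''thr'' i'"
    and "\<forall>k\<in>{1..c}. rmem s' ''thr'' (Suc i) k = real (Suc i)"
    and "\<forall>i. rmem s' ''thr'' i 0 = 0"
proof -
  define Inv :: "nat \<Rightarrow> store \<Rightarrow> bool" where "Inv k t \<longleftrightarrow>
    (\<forall>i'\<noteq>Suc i. rmem t ''thr'' i' = rmem s ''thr'' i') \<and>
    (\<forall>k\<in>{1..k}. rmem t ''thr'' (Suc i) k = real (Suc i)) \<and>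
    (\<forall>i. rmem t ''thr'' i 0 = 0)" for k t
  have "Inv c (exec A guard_row s)"
    unfolding guard_row_def
  proof (rule exec_For_invariant[where Inv = Inv], goal_cases)
    case (3 k t)
    have "nmem t ''i'' 0 = Suc i" using 3(3)[of "''i''"] assms(2) by simp
    with 3(1,2) assms(3,4) show ?case by (auto simp: Inv_def le_Suc_eq)
  qed (use assms in \<open>auto simp: Inv_def\<close>)
  then show "\<forall>i'\<noteq>Suc i. rmem s' ''thr'' i' = rmem s ''thr'' i'"
    and "\<forall>k\<in>{1..c}. rmem s' ''thr'' (Suc i) k = real (Suc i)"
    and "\<forall>i. rmem s' ''thr'' i 0 = 0"
    unfolding Inv_def s'_def by blast+
qed

lemma guards_setup:
  assumes "input I s" "rmem s ''thr'' = (\<lambda>_ _. 0)" "rmem s ''K'' 0 0 = 0"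
  defines "s' \<equiv> exec A guards_setup s"
  shows "\<forall>i\<in>{1..c}. \<forall>k\<in>{1..c}. rmem s' ''thr'' i k = real i"
    and "\<forall>i. rmem s' ''thr'' i 0 = 0"
    and "rmem s' ''K'' 0 0 = guard_cache I"
    and "\<forall>q\<in>{1..c}. nmem s' ''core'' q = c"
proof -
  \<comment> \<open>Row \<open>0\<close> is included so that the first guard row has a row to count
    from.\<close>
  define Inv :: "nat \<Rightarrow> store \<Rightarrow> bool" where "Inv i t \<longleftrightarrow>
    (\<forall>i'\<in>{0..i}. \<forall>k\<in>{1..c}. rmem t ''thr'' i' k = real i') \<and>
    (\<forall>i'. rmem t ''thr'' i' 0 = 0) \<and> rmem t ''K'' 0 0 = (\<Sum>i\<in>{1..i}. real i) \<and>
    (\<forall>q\<in>{1..i}. nmem t ''core'' q = c)" for i t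
  have "Inv c (exec A guards_setup s)"
    unfolding guards_setup_def
  proof (rule exec_For_invariant[where Inv = Inv], goal_cases)
    case (3 i t)
    have c: "nmem t ''c'' 0 = c"
      using assms(1) 3(3)[of "''c''"] by (simp add: input_def guard_row_def)
    define u where "u = tick 1 (tick 1 (nset ''i'' 0 (Suc i) t))"
    have thr: "rmem u ''thr'' = rmem t ''thr''" by (simp add: u_def)
    have "nmem u ''c'' 0 = c" "nmem u ''i'' 0 = Suc i"
      "\<forall>k\<in>{1..c}. rmem u ''thr'' i k = real i" "\<forall>i. rmem u ''thr'' i 0 = 0"
      using c \<open>Inv i t\<close> by (simp_all add: u_def Inv_def)
    note row = guard_row[OF this, unfolded thr]
    have "rmem (exec A guard_row u) ''K'' = rmem t ''K''"
      "nmem (exec A guard_row u) ''core'' = nmem t ''core''"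
      "nmem (exec A guard_row u) ''c'' 0 = c" "nmem (exec A guard_row u) ''i'' 0 = Suc i"
      using c by (simp_all add: nmem_exec rmem_exec guard_row_def u_def del: exec.simps)
    with row c \<open>Inv i t\<close> \<open>i < c\<close> show ?case
      unfolding exec.simps u_def[symmetric] by (auto simp: Inv_def le_Suc_eq)
  qed (use assms(1-3) in \<open>auto simp: Inv_def input_def\<close>)
  then show "\<forall>i\<in>{1..c}. \<forall>k\<in>{1..c}. rmem s' ''thr'' i k = real i"
    and "\<forall>i. rmem s' ''thr'' i 0 = 0"
    and "rmem s' ''K'' 0 0 = guard_cache I"
    and "\<forall>q\<in>{1..c}. nmem s' ''core'' q = c"
    by (auto simp: Inv_def s'_def guard_cache_def)
qed

lemma job_row:
  assumes "input I s" "nmem s ''j'' 0 = j" "j \<in> {1..n}" "\<forall>i. rmem s ''thr'' i 0 = 0"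
  defines "s' \<equiv> exec A job_row s"
  shows "\<forall>i\<noteq>c + j. rmem s' ''thr'' i = rmem s ''thr'' i \<and> rmem s' ''val'' i = rmem s ''val'' i"
    and "\<forall>k\<in>{1..c}. rmem s' ''thr'' (c + j) k = real k \<and> rmem s' ''val'' (c + j) k = runtime I k j"
    and "\<forall>i. rmem s' ''thr'' i 0 = 0"
proof -
  \<comment> \<open>Here the thresholds count along the row, starting from column \<open>0\<close>,
    which is therefore included.\<close>
  define Inv :: "nat \<Rightarrow> store \<Rightarrow> bool" where "Inv k t \<longleftrightarrow>
    (\<forall>i\<noteq>c + j. rmem t ''thr'' i = rmem s ''thr'' i \<and> rmem t ''val'' i = rmem s ''val'' i) \<and>
    (\<forall>k\<in>{0..k}. rmem t ''thr'' (c + j) k = real k) \<and>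
    (\<forall>k\<in>{1..k}. rmem t ''val'' (c + j) k = runtime I k j) \<and>
    (\<forall>i. rmem t ''thr'' i 0 = 0)" for k t
  have "Inv c (exec A job_row s)"
    unfolding job_row_def
  proof (rule exec_For_invariant[where Inv = Inv], goal_cases)
    case (3 k t)
    have "nmem t ''c'' 0 = c" "nmem t ''j'' 0 = j" "rmem t ''T'' (Suc k) j = runtime I (Suc k) j"
      using 3(1) 3(3)[of "''j''"] 3(3)[of "''c''"] 3(4)[of "''T''"] assms(1-3)
      by (simp_all add: input_def)
    with 3(1,2) assms(4) show ?case by (auto simp: Inv_def le_Suc_eq)
  qed (use assms in \<open>auto simp: Inv_def input_def\<close>)
  then show "\<forall>i\<noteq>c + j. rmem s' ''thr'' i = rmem s ''thr'' i \<and> rmem s' ''val'' i = rmem s ''val'' i"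
    and "\<forall>k\<in>{1..c}. rmem s' ''thr'' (c + j) k = real k \<and> rmem s' ''val'' (c + j) k = runtime I k j"
    and "\<forall>i. rmem s' ''thr'' i 0 = 0"
    unfolding Inv_def s'_def by auto
qed

lemma jobs_setup:
  assumes "input I s" "\<forall>i. rmem s ''thr'' i 0 = 0" "rmem s ''best'' 0 0 = 0"
  defines "s' \<equiv> exec A jobs_setup s"
  shows "\<forall>i\<in>{1..c}. rmem s' ''thr'' i = rmem s ''thr'' i"
    and "\<forall>j\<in>{1..n}. \<forall>k\<in>{1..c}.
      rmem s' ''thr'' (c + j) k = real k \<and> rmem s' ''val'' (c + j) k = runtime I k j"
    and "\<forall>j\<in>{1..n}. nmem s' ''S'' j = c"
    and "rmem s' ''best'' 0 0 = (\<Sum>j\<in>{1..n}. runtime I c j)"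
proof -
  define Inv :: "nat \<Rightarrow> store \<Rightarrow> bool" where "Inv j t \<longleftrightarrow>
    (\<forall>i\<in>{1..c}. rmem t ''thr'' i = rmem s ''thr'' i) \<and>
    (\<forall>j\<in>{1..j}. \<forall>k\<in>{1..c}.
      rmem t ''thr'' (c + j) k = real k \<and> rmem t ''val'' (c + j) k = runtime I k j) \<and>
    (\<forall>i. rmem t ''thr'' i 0 = 0) \<and>
    (\<forall>j\<in>{1..j}. nmem t ''S'' j = c) \<and>
    rmem t ''best'' 0 0 = (\<Sum>j\<in>{1..j}. runtime I c j)" for j t
  have "Inv n (exec A jobs_setup s)"
    unfolding jobs_setup_def
  proof (rule exec_For_invariant[where Inv = Inv], goal_cases)
    case (3 j t)
    define u where "u = tick 1 (tick 1 (nset ''j'' 0 (Suc j) t))"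
    have "input I u"
      using assms(1) 3(3)[of "''c''"] 3(3)[of "''n''"] 3(4)[of "''T''"]
      by (simp add: input_def job_row_def u_def)
    have same: "rmem u ''thr'' = rmem t ''thr''" "rmem u ''val'' = rmem t ''val''"
      by (simp_all add: u_def)
    have "nmem u ''j'' 0 = Suc j" "Suc j \<in> {1..n}" "\<forall>i. rmem u ''thr'' i 0 = 0"
      using \<open>Inv j t\<close> \<open>j < n\<close> by (simp_all add: u_def Inv_def)
    note row = job_row[OF \<open>input I u\<close> this, unfolded same]
    have *: "rmem (exec A job_row u) ''best'' = rmem t ''best''"
      "nmem (exec A job_row u) ''S'' = nmem t ''S''"
      "nmem (exec A job_row u) ''c'' 0 = c" "nmem (exec A job_row u) ''j'' 0 = Suc j"
      "rmem (exec A job_row u) ''T'' c (Suc j) = runtime I c (Suc j)"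
      using \<open>input I u\<close> \<open>j < n\<close> machines_ge_1[OF ordered]
      by (simp_all add: nmem_exec rmem_exec job_row_def input_def u_def del: exec.simps)
    with * row \<open>Inv j t\<close> \<open>j < n\<close> show ?case
      unfolding exec.simps u_def[symmetric] by (auto simp: Inv_def le_Suc_eq)
  qed (use assms(1-3) in \<open>auto simp: Inv_def input_def\<close>)
  then show "\<forall>i\<in>{1..c}. rmem s' ''thr'' i = rmem s ''thr'' i"
    and "\<forall>j\<in>{1..n}. \<forall>k\<in>{1..c}.
      rmem s' ''thr'' (c + j) k = real k \<and> rmem s' ''val'' (c + j) k = runtime I k j"
    and "\<forall>j\<in>{1..n}. nmem s' ''S'' j = c"
    and "rmem s' ''best'' 0 0 = (\<Sum>j\<in>{1..n}. runtime I c j)"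
    unfolding Inv_def s'_def by blast+
qed

lemma guess_row:
  assumes "nmem s ''c'' 0 = c" "nmem s ''i'' 0 = i" "rmem s ''D'' 0 0 = D"
  defines "s' \<equiv> exec A guess_row s"
  shows "\<forall>i'\<noteq>i. rmem s' ''val'' i' = rmem s ''val'' i'" and "\<forall>k\<in>{1..c}. rmem s' ''val'' i k = D"
proof -
  define Inv :: "nat \<Rightarrow> store \<Rightarrow> bool" where "Inv k t \<longleftrightarrow>
    (\<forall>i'\<noteq>i. rmem t ''val'' i' = rmem s ''val'' i') \<and> (\<forall>k\<in>{1..k}. rmem t ''val'' i k = D)" for k t
  have "Inv c (exec A guess_row s)"
    unfolding guess_row_def
  proof (rule exec_For_invariant[where Inv = Inv], goal_cases)
    case (3 k t)
    have "nmem t ''i'' 0 = i" "rmem t ''D'' 0 0 = D"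
      using 3(3)[of "''i''"] 3(4)[of "''D''"] assms(2,3) by simp_all
    with 3(2) show ?case by (auto simp: Inv_def le_Suc_eq)
  qed (use assms in \<open>auto simp: Inv_def\<close>)
  then show "\<forall>i'\<noteq>i. rmem s' ''val'' i' = rmem s ''val'' i'" and "\<forall>k\<in>{1..c}. rmem s' ''val'' i k = D"
    unfolding Inv_def s'_def by blast+
qed

lemma guess_setup:
  assumes "nmem s ''c'' 0 = c" "rmem s ''D'' 0 0 = D"
  defines "s' \<equiv> exec A guess_setup s"
  shows "\<forall>i>c. rmem s' ''val'' i = rmem s ''val'' i"
    and "\<forall>i\<in>{1..c}. \<forall>k\<in>{1..c}. rmem s' ''val'' i k = D"
proof -
  define Inv :: "nat \<Rightarrow> store \<Rightarrow> bool" where "Inv i t \<longleftrightarrow>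
    (\<forall>i'>c. rmem t ''val'' i' = rmem s ''val'' i') \<and>
    (\<forall>i\<in>{1..i}. \<forall>k\<in>{1..c}. rmem t ''val'' i k = D)" for i t
  have "Inv c (exec A guess_setup s)"
    unfolding guess_setup_def
  proof (rule exec_For_invariant[where Inv = Inv], goal_cases)
    case (3 i t)
    define u where "u = tick 1 (nset ''i'' 0 (Suc i) t)"
    have u: "nmem u ''c'' 0 = c" "rmem u ''D'' 0 0 = D" "nmem u ''i'' 0 = Suc i"
      using assms(1,2) 3(3)[of "''c''"] 3(4)[of "''D''"] by (simp_all add: guess_row_def u_def)
    have same: "rmem u ''val'' = rmem t ''val''" by (simp add: u_def)
    note row = guess_row[OF u(1,3,2), unfolded same]
    with \<open>Inv i t\<close> \<open>i < c\<close> show ?case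
      unfolding exec.simps u_def[symmetric] by (auto simp: Inv_def le_Suc_eq)
  qed (use assms(1-3) in \<open>auto simp: Inv_def\<close>)
  then show "\<forall>i>c. rmem s' ''val'' i = rmem s ''val'' i"
    and "\<forall>i\<in>{1..c}. \<forall>k\<in>{1..c}. rmem s' ''val'' i k = D"
    unfolding Inv_def s'_def by blast+
qed

text \<open>Every value written to \<open>core\<close> is a machine number, so its entries stay in
  range whatever the subroutine returns. If the guards sit on distinct cores, no later iteration
  overwrites the entry of an earlier guard.\<close>

lemma match_cores:
  assumes "nmem s ''c'' 0 = c" "\<forall>q\<in>{1..c}. nmem s ''core'' q \<in> {1..c}"
  defines "s' \<equiv> exec A match_cores s"
  shows "\<forall>q\<in>{1..c}. nmem s' ''core'' q \<in> {1..c}"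
    and "\<forall>q\<in>{1..c}. rmem s' ''load'' q 0 = 0"
    and "inj_on (nmem s ''asg'') {1..c} \<Longrightarrow> \<forall>i\<in>{1..c}. nmem s' ''core'' (nmem s ''asg'' i) = i"
proof -
  define Inv :: "nat \<Rightarrow> store \<Rightarrow> bool" where "Inv i t \<longleftrightarrow>
    (\<forall>q\<in>{1..c}. nmem t ''core'' q \<in> {1..c}) \<and> (\<forall>q\<in>{1..i}. rmem t ''load'' q 0 = 0) \<and>
    (inj_on (nmem s ''asg'') {1..c} \<longrightarrow> (\<forall>i\<in>{1..i}. nmem t ''core'' (nmem s ''asg'' i) = i))"
    for i t
  have "Inv c (exec A match_cores s)"
    unfolding match_cores_def
  proof (rule exec_For_invariant[where Inv = Inv], goal_cases)
    case (3 i t)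
    have asg: "nmem t ''asg'' = nmem s ''asg''" using 3(3)[of "''asg''"] by simp
    have "nmem s ''asg'' i' \<noteq> nmem s ''asg'' (Suc i)"
      if "inj_on (nmem s ''asg'') {1..c}" "i' \<in> {1..i}" for i'
      using that \<open>i < c\<close> by (auto dest: inj_onD)
    with asg 3(1,2) show ?case by (auto simp: Inv_def le_Suc_eq)
  qed (use assms in \<open>auto simp: Inv_def\<close>)
  then show "\<forall>q\<in>{1..c}. nmem s' ''core'' q \<in> {1..c}"
    and "\<forall>q\<in>{1..c}. rmem s' ''load'' q 0 = 0"
    and "inj_on (nmem s ''asg'') {1..c} \<Longrightarrow> \<forall>i\<in>{1..c}. nmem s' ''core'' (nmem s ''asg'' i) = i"
    unfolding Inv_def s'_def by blast+
qed

text \<open>Each job raises a single load, so comparing \<open>max\<close> with that load keeps it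
  at least as large as all loads. It also never exceeds the makespan of the complete schedule, and
  after the last job the two bounds meet.\<close>

lemma evaluate:
  assumes "input I s" "\<forall>q\<in>{1..c}. rmem s ''load'' q 0 = 0" "rmem s ''max'' 0 0 = 0"
  defines "S \<equiv> \<lambda>j. nmem s ''core'' (nmem s ''asg'' (c + j))"
  assumes "is_schedule I S"
  defines "s' \<equiv> exec A evaluate s"
  shows "\<forall>j\<in>{1..n}. nmem s' ''cand'' j = S j"
    and "rmem s' ''max'' 0 0 = sched_makespan I S"
proof -
  let ?load = "\<lambda>q j. \<Sum>j'\<in>{j'\<in>{1..j}. S j' = q}. runtime I q j'"
  define Inv :: "nat \<Rightarrow> store \<Rightarrow> bool" where "Inv j t \<longleftrightarrow>
    (\<forall>j\<in>{1..j}. nmem t ''cand'' j = S j) \<and>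
    (\<forall>q\<in>{1..c}. rmem t ''load'' q 0 = ?load q j \<and> ?load q j \<le> rmem t ''max'' 0 0) \<and>
    rmem t ''max'' 0 0 \<le> sched_makespan I S" for j t
  have load_le: "?load q j \<le> sched_makespan I S" if "q \<in> {1..c}" "j \<le> n" for q j
  proof -
    have "?load q j \<le> ?load q n"
      using that runtime_pos[OF ordered that(1), THEN less_imp_le] by (intro sum_mono2) auto
    also have "\<dots> \<le> sched_makespan I S" by (rule machine_load_le_makespan[OF that(1)])
    finally show ?thesis .
  qed
  have "Inv n (exec A evaluate s)"
    unfolding evaluate_def
  proof (rule exec_For_invariant[where Inv = Inv], goal_cases)
    case (3 j t)
    let ?q = "S (Suc j)"
    have q: "?q \<in> {1..c}" using assms(5) \<open>j < n\<close> by (simp add: is_schedule_def)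
    have t: "nmem t ''c'' 0 = c" "nmem t ''core'' = nmem s ''core''" "nmem t ''asg'' = nmem s ''asg''"
      "rmem t ''T'' ?q (Suc j) = runtime I ?q (Suc j)"
      using 3(3)[of "''c''"] 3(3)[of "''core''"] 3(3)[of "''asg''"] 3(4)[of "''T''"]
        assms(1) q \<open>j < n\<close> by (simp_all add: input_def)
    have S: "nmem t ''core'' (nmem t ''asg'' (Suc (c + j))) = ?q"
      by (simp add: t(2,3) S_def)
    have load_Suc: "?load q (Suc j) = ?load q j + (if q = ?q then runtime I q (Suc j) else 0)" for q
    proof -
      have "{j'\<in>{1..Suc j}. S j' = q} =
          (if q = ?q then insert (Suc j) {j'\<in>{1..j}. S j' = q} else {j'\<in>{1..j}. S j' = q})"
        by (auto simp: le_Suc_eq)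
      then show ?thesis by simp
    qed
    have max_load: "?load ?q (Suc j) \<le> sched_makespan I S" using q \<open>j < n\<close> by (intro load_le) auto
    define u where "u = exec A
       (Seq (NSet ''cand'' jN (NGet ''core'' (NGet ''asg'' (NAdd cN jN))))
       (Seq (RSet ''load'' (NGet ''cand'' jN) (NConst 0)
              (RAdd (RGet ''load'' (NGet ''cand'' jN) (NConst 0))
                    (RGet ''T'' (NGet ''cand'' jN) jN)))
            (Cond (RLess (rscalar ''max'') (RGet ''load'' (NGet ''cand'' jN) (NConst 0)))
                  (set_rscalar ''max'' (RGet ''load'' (NGet ''cand'' jN) (NConst 0)))
                  Skip))) (tick 1 (nset ''j'' 0 (Suc j) t))"
    have "nmem u ''cand'' = (nmem t ''cand'')(Suc j := ?q)"
      by (simp add: u_def S t(1))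
    then have cand: "\<forall>j'\<in>{1..Suc j}. nmem u ''cand'' j' = S j'"
      using \<open>Inv j t\<close> by (auto simp: Inv_def le_Suc_eq)
    have "rmem u ''load'' q 0 =
        rmem t ''load'' q 0 + (if q = ?q then runtime I q (Suc j) else 0)" for q
      using t(4) by (simp add: u_def S t(1))
    then have load: "rmem u ''load'' q 0 = ?load q (Suc j)" if "q \<in> {1..c}" for q
      using that \<open>Inv j t\<close> load_Suc[of q] by (simp add: Inv_def)
    have "rmem u ''max'' 0 0 = max (rmem t ''max'' 0 0) (rmem u ''load'' ?q 0)"
      by (simp add: u_def S t(1))
    then have max: "rmem u ''max'' 0 0 = max (rmem t ''max'' 0 0) (?load ?q (Suc j))"
      using load[OF q] by simp
    have "?load q (Suc j) \<le> rmem u ''max'' 0 0" if "q \<in> {1..c}" for q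
      using that \<open>Inv j t\<close> load_Suc[of q] by (cases "q = ?q") (auto simp: max Inv_def le_max_iff_disj)
    moreover have "rmem u ''max'' 0 0 \<le> sched_makespan I S"
      using \<open>Inv j t\<close> max_load by (simp add: max Inv_def)
    ultimately have "Inv (Suc j) u" unfolding Inv_def using cand load by blast
    then show ?case by (simp only: u_def)
  qed (use assms(1-3) sched_makespan_nonneg[OF ordered] in \<open>auto simp: Inv_def input_def\<close>)
  then show "\<forall>j\<in>{1..n}. nmem s' ''cand'' j = S j" "rmem s' ''max'' 0 0 = sched_makespan I S"
    using sched_makespan_le[OF machines_ge_1[OF ordered], of S "rmem s' ''max'' 0 0"]
    by (auto simp: Inv_def s'_def)
qed

text \<open>Only the entries of jobs are copied, which suffices because the makespan ignores all
  others.\<close>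

lemma update:
  assumes "nmem s ''n'' 0 = n" "rmem s ''max'' 0 0 = sched_makespan I (nmem s ''cand'')"
    and "is_schedule I (nmem s ''cand'')" "is_schedule I (nmem s ''S'')"
    and "sched_makespan I (nmem s ''S'') \<le> rmem s ''best'' 0 0"
  defines "s' \<equiv> exec A update s"
  shows "is_schedule I (nmem s' ''S'')"
    and "sched_makespan I (nmem s' ''S'') \<le> rmem s' ''best'' 0 0"
    and "rmem s' ''best'' 0 0 = min (rmem s ''best'' 0 0) (rmem s ''max'' 0 0)"
proof -
  define Inv :: "nat \<Rightarrow> store \<Rightarrow> bool" where "Inv j t \<longleftrightarrow>
    (\<forall>j\<in>{1..j}. nmem t ''S'' j = nmem s ''cand'' j)" for j t
  let ?copy = "For ''j'' nN (NSet ''S'' jN (NGet ''cand'' jN))"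
  define u where "u = tick 1 (rset ''best'' 0 0 (rmem s ''max'' 0 0) (tick 1 (tick 1 s)))"
  have "Inv n (exec A ?copy u)"
  proof (rule exec_For_invariant[where Inv = Inv], goal_cases)
    case (3 j t)
    have "nmem t ''cand'' = nmem s ''cand''" using 3(3)[of "''cand''"] by (simp add: u_def)
    with 3(2) show ?case by (auto simp: Inv_def le_Suc_eq)
  qed (use assms in \<open>auto simp: Inv_def u_def\<close>)
  then have S: "nmem (exec A ?copy u) ''S'' j = nmem s ''cand'' j" if "j \<in> {1..n}" for j
    using that by (simp add: Inv_def)
  moreover from this have "sched_makespan I (nmem (exec A ?copy u) ''S'') =
      sched_makespan I (nmem s ''cand'')" by (rule sched_makespan_cong)
  moreover have "is_schedule I (nmem (exec A ?copy u) ''S'')"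
    using assms(3) S by (simp add: is_schedule_def)
  moreover have "rmem (exec A ?copy u) ''best'' 0 0 = rmem s ''max'' 0 0"
    by (simp add: rmem_exec u_def del: exec.simps)
  moreover have "s' = (if rmem s ''max'' 0 0 < rmem s ''best'' 0 0 then exec A ?copy u else tick 1 (tick 1 s))"
    by (simp add: s'_def update_def u_def)
  ultimately show "is_schedule I (nmem s' ''S'')"
    and "sched_makespan I (nmem s' ''S'') \<le> rmem s' ''best'' 0 0"
    and "rmem s' ''best'' 0 0 = min (rmem s ''best'' 0 0) (rmem s ''max'' 0 0)"
    using assms(2,4,5) by (auto simp del: exec.simps)
qed

lemma initially_ready:
  fixes \<epsilon> \<chi> :: real
  defines "s \<equiv> exec A jobs_setup (tick 1 (exec A guards_setup (tick 1 (initial_store \<epsilon> \<chi> I))))"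
  shows "ready I s" and "rmem s ''D'' 0 0 = 0"
proof -
  define s0 where "s0 = tick 1 (initial_store \<epsilon> \<chi> I)"
  define s1 where "s1 = tick 1 (exec A guards_setup s0)"
  have s0: "input I s0" "rmem s0 ''thr'' = (\<lambda>_ _. 0)" "rmem s0 ''K'' 0 0 = 0"
    "rmem s0 ''best'' 0 0 = 0" "rmem s0 ''D'' 0 0 = 0"
    by (simp_all add: s0_def input_def initial_store_def fun_eq_iff)
  have frame1: "nmem s1 ''c'' = nmem s0 ''c''" "nmem s1 ''n'' = nmem s0 ''n''"
    "rmem s1 ''T'' = rmem s0 ''T''" "rmem s1 ''best'' = rmem s0 ''best''"
    "rmem s1 ''D'' = rmem s0 ''D''"
    by (simp_all add: s1_def nmem_exec rmem_exec guards_setup_def guard_row_def del: exec.simps)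
  have s1: "input I s1" "rmem s1 ''best'' 0 0 = 0"
    using s0 frame1 by (simp_all add: input_cong[of s1 s0])
  have s: "s = exec A jobs_setup s1" by (simp add: s_def s1_def s0_def)
  have frame2: "nmem s ''c'' = nmem s1 ''c''" "nmem s ''n'' = nmem s1 ''n''"
    "rmem s ''T'' = rmem s1 ''T''" "rmem s ''K'' = rmem s1 ''K''" "nmem s ''core'' = nmem s1 ''core''"
    "rmem s ''D'' = rmem s1 ''D''"
    by (simp_all add: s nmem_exec rmem_exec jobs_setup_def job_row_def del: exec.simps)
  have "\<forall>i\<in>{1..c}. \<forall>k\<in>{1..c}. rmem s1 ''thr'' i k = real i" "\<forall>i. rmem s1 ''thr'' i 0 = 0"
    "rmem s1 ''K'' 0 0 = guard_cache I" "\<forall>q\<in>{1..c}. nmem s1 ''core'' q = c"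
    using guards_setup[OF s0(1-3)] by (simp_all add: s1_def)
  note g = this
  note j = jobs_setup[OF s1(1) g(2) s1(2), folded s]
  have "is_schedule I (nmem s ''S'')"
    using j(3) machines_ge_1[OF ordered] by (simp add: is_schedule_def)
  moreover have "sched_makespan I (nmem s ''S'') \<le> rmem s ''best'' 0 0"
    unfolding j(4) using j(3) by (intro sched_makespan_fastest[OF ordered]) blast
  ultimately show "ready I s"
    using s1(1) g j(1,2) frame2 machines_ge_1[OF ordered] input_cong[OF frame2(1-3)]
    by (simp add: ready_def)
  show "rmem s ''D'' 0 0 = 0" using s0(5) frame1(5) frame2(6) by simp
qed

text \<open>Every guess, good or bad, preserves \<open>ready\<close> and does not worsen
  \<open>best\<close>. The premise of the last claim puts the makespan guaranteed for the
  subroutine's solution below \<open>2 * D\<close>, so that the guards identify the machines;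
  removing the guard load gives the bound.\<close>

lemma try_guess:
  assumes approx: "joint_approx_algorithm (1 + \<epsilon>) A" and "0 \<le> \<epsilon>"
    and "ready I s" "nmem s ''g'' 0 \<in> {1..n}" "0 \<le> rmem s ''D'' 0 0" "0 < N"
  defines "D \<equiv> rmem s ''D'' 0 0 + runtime I c (nmem s ''g'' 0) / real N"
    and "s' \<equiv> exec A (try_guess N) s"
  shows "ready I s'" and "rmem s' ''D'' 0 0 = D" and "rmem s' ''best'' 0 0 \<le> rmem s ''best'' 0 0"
    and "(1 + \<epsilon>) * (D + sched_opt I) < 2 * D \<Longrightarrow>
      rmem s' ''best'' 0 0 \<le> (1 + \<epsilon>) * (D + sched_opt I) - D"
proof -
  have "runtime I c (nmem s ''g'' 0) > 0"
    using assms(4) machines_ge_1[OF ordered] by (intro runtime_pos[OF ordered]) auto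
  then have D_pos: "0 < D" using assms(5,6) by (simp add: D_def add_nonneg_pos)
  have input: "input I s" and c: "nmem s ''c'' 0 = c" and n: "nmem s ''n'' 0 = n"
    using assms(3) by (simp_all add: ready_def input_def)
  \<comment> \<open>The stores after raising the guess, after its setup, after the subroutine, after
    matching and resetting \<open>max\<close>, and after the evaluation.\<close>
  define s1 where "s1 = tick 1 (tick 1 (rset ''D'' 0 0 D (tick 1 s)))"
  define s2 where "s2 = tick 1 (exec A guess_setup s1)"
  define s3 where "s3 = tick 1 (tick (1 + c + (c + n) + (c + n) * c) (call A c (guard_cache I) (c + n) c s2))"
  define s4 where "s4 = tick 1 (tick 1 (rset ''max'' 0 0 0 (tick 1 (exec A match_cores s3))))"
  define s5 where "s5 = exec A evaluate s4"
  have D_eq: "rmem s ''D'' 0 0 + rmem s ''T'' (nmem s ''c'' 0) (nmem s ''g'' 0) / real N = D"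
    using input assms(4) machines_ge_1[OF ordered] by (simp add: D_def input_def)
  have frame2: "nmem s2 a = nmem s a" if "a \<notin> {''i'', ''k''}" for a
    using that by (simp add: s2_def s1_def nmem_exec guess_setup_def guess_row_def del: exec.simps)
  have rframe2: "rmem s2 a = rmem s a" if "a \<notin> {''D'', ''val''}" for a
    using that by (simp add: s2_def s1_def rmem_exec guess_setup_def guess_row_def del: exec.simps)
  have set_D: "exec A (set_rscalar ''D'' (RAdd (rscalar ''D'') (RDiv (RGet ''T'' cN (scalar ''g'')) (RConst N))))
      (tick 1 s) = tick 1 (rset ''D'' 0 0 D (tick 1 s))"
    by (simp add: D_eq)
  have call: "exec A (Call cN (rscalar ''K'') (NAdd cN nN) cN) s2 =
      tick (1 + c + (c + n) + (c + n) * c) (call A c (guard_cache I) (c + n) c s2)"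
    using c n frame2[of "''c''"] frame2[of "''n''"] rframe2[of "''K''"] assms(3)
    by (simp add: ready_def Let_def)
  have set_max: "exec A (set_rscalar ''max'' (RConst 0)) t = tick 1 (rset ''max'' 0 0 0 t)" for t
    by simp
  have s': "s' = exec A update s5"
    unfolding s'_def try_guess_def exec.simps(4) set_D s1_def[symmetric] s2_def[symmetric] call
      s3_def[symmetric] set_max s4_def[symmetric] s5_def[symmetric]
    by (simp only: s5_def s4_def)
  have "rmem s2 ''D'' 0 0 = D"
    by (simp add: s2_def s1_def rmem_exec guess_setup_def guess_row_def del: exec.simps)
  have "nmem s1 ''c'' 0 = c" "rmem s1 ''D'' 0 0 = D" "rmem s1 ''val'' = rmem s ''val''"
    using c by (simp_all add: s1_def)
  note guess = guess_setup[OF this(1,2), unfolded this(3)]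
  have val: "\<forall>i>c. rmem s2 ''val'' i = rmem s ''val'' i"
    "\<forall>i\<in>{1..c}. \<forall>k\<in>{1..c}. rmem s2 ''val'' i k = D"
    using guess by (simp_all add: s2_def)
  have enc: "encodes I D s2"
    using assms(3) val rframe2[of "''thr''"] by (simp add: encodes_def ready_def)
  obtain p \<sigma> where p\<sigma>: "A (guess_instance I s2) = (p, \<sigma>)" by fastforce
  have sol: "is_joint_solution (guess_instance I s2) (p, \<sigma>)"
    and le_opt: "joint_makespan (guess_instance I s2) (p, \<sigma>) \<le>
      ereal (1 + \<epsilon>) * joint_opt (guess_instance I s2)"
    using approx valid_guess_instance[OF ordered enc D_pos] p\<sigma>
    by (auto simp: joint_approx_algorithm_def)
  obtain S' where S': "is_schedule I S'" "sched_makespan I S' = sched_opt I"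
    using sched_opt_attained[OF machines_ge_1[OF ordered]] by metis
  note le_opt
  also have "ereal (1 + \<epsilon>) * joint_opt (guess_instance I s2) \<le>
      ereal (1 + \<epsilon>) * ereal (D + sched_opt I)"
    using joint_opt_guess_le[OF ordered enc S'(1)] S'(2) \<open>0 \<le> \<epsilon>\<close>
    by (intro ereal_mult_left_mono) auto
  finally have le: "joint_makespan (guess_instance I s2) (p, \<sigma>) \<le> ereal ((1 + \<epsilon>) * (D + sched_opt I))"
    by simp
  have asg3: "nmem s3 ''asg'' = (\<lambda>j. if j \<in> {1..c + n} then \<sigma> j else 0)"
    by (simp add: s3_def nmem_call_asg p\<sigma> cong: if_cong)
  have nframe3: "nmem s3 a = nmem s a" if "a \<notin> {''asg'', ''i'', ''k''}" for a
    using that frame2[of a] by (simp add: s3_def nmem_call)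
  have rframe3: "rmem s3 a = rmem s2 a" if "a \<noteq> ''part''" for a
    using that by (simp add: s3_def rmem_call)
  have "nmem s3 ''c'' 0 = c" "\<forall>q\<in>{1..c}. nmem s3 ''core'' q \<in> {1..c}"
    using c nframe3[of "''c''"] nframe3[of "''core''"] assms(3) by (simp_all add: ready_def)
  note match = match_cores[OF this]
  have nframe4: "nmem s4 a = nmem s3 a" if "a \<notin> {''core'', ''i''}" for a
    using that by (simp add: s4_def nmem_exec match_cores_def del: exec.simps)
  have rframe4: "rmem s4 a = rmem s3 a" if "a \<notin> {''load'', ''max''}" for a
    using that by (simp add: s4_def rmem_exec match_cores_def del: exec.simps)
  have core4: "nmem s4 ''core'' = nmem (exec A match_cores s3) ''core''" by (simp add: s4_def)
  define S where "S = (\<lambda>j. nmem s4 ''core'' (nmem s4 ''asg'' (c + j)))"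
  have asg4: "nmem s4 ''asg'' = nmem s3 ''asg''" using nframe4 by simp
  have \<sigma>: "\<sigma> j \<in> {1..c}" if "j \<in> {1..c + n}" for j
    using sol that by (simp add: is_joint_solution_def table_instance_def)
  \<comment> \<open>This holds even if some core has no guard, since \<open>core\<close> has all its
    relevant entries in range.\<close>
  have S: "is_schedule I S"
    using \<sigma> match(1) by (simp add: is_schedule_def S_def asg4 asg3 core4)
  have "input I s4"
    using input nframe4 nframe3 rframe4 rframe3 rframe2 by (subst input_cong[of s4 s]) simp_all
  moreover have "\<forall>q\<in>{1..c}. rmem s4 ''load'' q 0 = 0" "rmem s4 ''max'' 0 0 = 0"
    using match(2) by (simp_all add: s4_def)
  ultimately have eval: "\<forall>j\<in>{1..n}. nmem s5 ''cand'' j = S j" "rmem s5 ''max'' 0 0 = sched_makespan I S"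
    using evaluate[of s4] S by (simp_all add: s5_def S_def)
  have nframe5: "nmem s5 a = nmem s4 a" if "a \<notin> {''j'', ''cand''}" for a
    using that by (simp add: s5_def nmem_exec evaluate_def del: exec.simps)
  have rframe5: "rmem s5 a = rmem s4 a" if "a \<notin> {''load'', ''max''}" for a
    using that by (simp add: s5_def rmem_exec evaluate_def del: exec.simps)
  have nsame: "nmem s5 a = nmem s a" if "a \<in> {''c'', ''n'', ''S''}" for a
    using that nframe5[of a] nframe4[of a] nframe3[of a] by auto
  have rsame: "rmem s5 a = rmem s a" if "a \<in> {''T'', ''thr'', ''K'', ''best''}" for a
    using that rframe5[of a] rframe4[of a] rframe3[of a] rframe2[of a] by auto
  have "is_schedule I (nmem s5 ''cand'')" using S eval(1) by (simp add: is_schedule_def)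
  moreover have "rmem s5 ''max'' 0 0 = sched_makespan I (nmem s5 ''cand'')"
    using eval by (metis sched_makespan_cong)
  ultimately have upd: "is_schedule I (nmem s' ''S'')"
    "sched_makespan I (nmem s' ''S'') \<le> rmem s' ''best'' 0 0"
    "rmem s' ''best'' 0 0 = min (rmem s ''best'' 0 0) (sched_makespan I S)"
    using update[of s5] assms(3) n nsame rsame eval(2) by (simp_all add: s' ready_def)
  have nframe': "nmem s' a = nmem s5 a" if "a \<notin> {''j'', ''S''}" for a
    using that by (simp add: s' nmem_exec update_def del: exec.simps)
  have rframe': "rmem s' a = rmem s5 a" if "a \<noteq> ''best''" for a
    using that by (simp add: s' rmem_exec update_def del: exec.simps)
  have "input I s'"
    using input nframe' rframe' nsame rsame by (subst input_cong[of s' s]) simp_all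
  moreover have "rmem s' ''val'' = rmem s2 ''val''"
    using rframe' rframe5 rframe4 rframe3 by simp
  moreover have "nmem s' ''core'' = nmem s4 ''core''" using nframe' nframe5 by simp
  ultimately show "ready I s'"
    using upd(1,2) assms(3) rframe' rsame match(1) val(1) by (simp add: ready_def core4)
  show "rmem s' ''D'' 0 0 = D"
    using \<open>rmem s2 ''D'' 0 0 = D\<close> rframe' rframe5 rframe4 rframe3 by simp
  show "rmem s' ''best'' 0 0 \<le> rmem s ''best'' 0 0"
    unfolding upd(3) by (rule min.cobounded1)
  assume less: "(1 + \<epsilon>) * (D + sched_opt I) < 2 * D"
  have "inj_on \<sigma> {1..c}"
    using ordered enc D_pos sol le less by (rule guess_solution(1))
  moreover have "inj_on (nmem s3 ''asg'') {1..c} \<longleftrightarrow> inj_on \<sigma> {1..c}"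
    by (rule inj_on_cong) (simp add: asg3)
  ultimately have "inj_on (nmem s3 ''asg'') {1..c}" by simp
  then have core: "nmem s4 ''core'' (\<sigma> i) = i" if "i \<in> {1..c}" for i
    using match(3) that by (simp add: core4 asg3)
  have "sched_makespan I S \<le> (1 + \<epsilon>) * (D + sched_opt I) - D"
    using ordered enc D_pos sol le less
  proof (rule guess_solution(2))
    fix j i assume "j \<in> {1..n}" "i \<in> {1..c}" "\<sigma> (c + j) = \<sigma> i"
    then show "S j = i" using core by (simp add: S_def asg4 asg3)
  qed
  then show "rmem s' ''best'' 0 0 \<le> (1 + \<epsilon>) * (D + sched_opt I) - D"
    using upd(3) by simp
qed

text \<open>Relative to the optimum, good guesses lie between
  \<open>(1 + \<epsilon>) / (1 - \<epsilon>)\<close> and \<open>hi\<close>. By \<open>gap\<close>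
  this window is at least one increment long, so it cannot be jumped over; by \<open>large\<close>,
  \<open>L\<close> passes get beyond its lower end.\<close>

lemma scheduler:
  fixes \<epsilon> \<chi> hi :: real
  assumes approx: "joint_approx_algorithm (1 + \<epsilon>) A" and "0 \<le> \<epsilon>" "\<epsilon> < 1" "0 < n" "0 < N"
    and gap: "1 / real N \<le> hi - (1 + \<epsilon>) / (1 - \<epsilon>)"
    and large: "(1 + \<epsilon>) / (1 - \<epsilon>) < real L / real N"
  defines "S \<equiv> computed_schedule (scheduler N L) A \<epsilon> \<chi> I"
  shows "is_schedule I S" and "sched_makespan I S \<le> (1 + \<epsilon> + \<epsilon> * hi) * sched_opt I"
proof -
  let ?lo = "(1 + \<epsilon>) / (1 - \<epsilon>)" and ?opt = "sched_opt I"
  let ?T = "\<lambda>g. runtime I c g / real N"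
  obtain S' where S': "is_schedule I S'" "sched_makespan I S' = ?opt"
    and opt_le: "\<And>S. is_schedule I S \<Longrightarrow> ?opt \<le> sched_makespan I S"
    using sched_opt_attained[OF machines_ge_1[OF ordered]] by metis
  have T_le_opt: "runtime I c g \<le> ?opt" if "g \<in> {1..n}" for g
    using fastest_runtime_le_makespan[OF ordered S'(1) that] S'(2) by simp
  have T_pos: "0 < runtime I c g" if "g \<in> {1..n}" for g
    using that machines_ge_1[OF ordered] by (intro runtime_pos[OF ordered]) auto
  have opt_pos: "0 < ?opt" using T_le_opt[of 1] T_pos[of 1] \<open>0 < n\<close> by simp
  have "is_schedule I (\<lambda>_. c)" using machines_ge_1[OF ordered] by (simp add: is_schedule_def)
  then have opt_le_sum: "?opt \<le> (\<Sum>g\<in>{1..n}. runtime I c g)"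
    using opt_le sched_makespan_fastest[OF ordered, of "\<lambda>_. c"] by fastforce
  \<comment> \<open>Once the guess has passed the lower end of the window, a good schedule has been
    recorded; at guess \<open>0\<close> this is vacuous.\<close>
  define Inv :: "real \<Rightarrow> store \<Rightarrow> bool" where "Inv D t \<longleftrightarrow> ready I t \<and> rmem t ''D'' 0 0 = D \<and>
    (?lo * ?opt < D \<longrightarrow> rmem t ''best'' 0 0 \<le> (1 + \<epsilon> + \<epsilon> * hi) * ?opt)" for D t
  \<comment> \<open>The counters \<open>a\<close> and \<open>g\<close> do not occur in the
    invariant, so starting an iteration preserves it.\<close>
  have Inv_cong: "Inv D t \<longleftrightarrow> Inv D u" if "rmem t = rmem u"
    "\<And>a. a \<notin> {''a'', ''g''} \<Longrightarrow> nmem t a = nmem u a" for D t u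
    using that by (simp add: Inv_def ready_def input_def)
  have guess: "Inv (D + ?T g) (exec A (try_guess N) t)"
    if "Inv D t" "0 \<le> D" "nmem t ''g'' 0 = g" "g \<in> {1..n}" for D g t
  proof -
    have t: "ready I t" "rmem t ''D'' 0 0 = D" using that(1) by (simp_all add: Inv_def)
    note step = try_guess[OF approx \<open>0 \<le> \<epsilon>\<close> t(1), of N, unfolded that(3) t(2), OF that(4,2) \<open>0 < N\<close>]
    have "rmem (exec A (try_guess N) t) ''best'' 0 0 \<le> (1 + \<epsilon> + \<epsilon> * hi) * ?opt"
      if lo: "?lo * ?opt < D + ?T g"
    proof (cases "?lo * ?opt < D")
      case True
      then show ?thesis using \<open>Inv D t\<close> step(3) by (simp add: Inv_def)
    next
      \<comment> \<open>This guess is the first beyond the lower end. Its increment is at most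
        \<open>?opt / N\<close>, so it does not exceed \<open>hi * ?opt\<close>.\<close>
      case False
      have "?T g \<le> ?opt * (1 / real N)"
        using T_le_opt[OF \<open>g \<in> {1..n}\<close>] by (simp add: divide_right_mono)
      also have "\<dots> \<le> ?opt * (hi - ?lo)" using gap opt_pos by (intro mult_left_mono) auto
      finally have "D + ?T g \<le> hi * ?opt" using False by (simp add: algebra_simps)
      then have le: "\<epsilon> * (D + ?T g) \<le> \<epsilon> * (hi * ?opt)"
        using \<open>0 \<le> \<epsilon>\<close> by (rule mult_left_mono)
      \<comment> \<open>Beyond the lower end, the premise of the last claim of
        \<open>try_guess\<close> holds.\<close>
      have "(1 + \<epsilon>) * y < (1 - \<epsilon>) * x" if "?lo * y < x" for x y
        using that \<open>\<epsilon> < 1\<close> by (simp add: field_simps)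
      from this[OF lo] have "(1 + \<epsilon>) * (D + ?T g + ?opt) < 2 * (D + ?T g)"
        unfolding ring_distribs by linarith
      from step(4)[OF this] le show ?thesis unfolding ring_distribs mult.assoc by linarith
    qed
    then show ?thesis using step(1,2) by (simp add: Inv_def)
  qed
  define s where "s = exec A jobs_setup (tick 1 (exec A guards_setup (tick 1 (initial_store \<epsilon> \<chi> I))))"
  let ?sum = "\<Sum>g\<in>{1..n}. ?T g"
  let ?inner = "For ''g'' nN (try_guess N)"
  have sum_nonneg: "0 \<le> (\<Sum>g\<in>{1..m}. ?T g)" if "m \<le> n" for m
    using that T_pos by (intro sum_nonneg) (simp add: less_imp_le)
  have "0 \<le> ?lo * ?opt" using \<open>0 \<le> \<epsilon>\<close> \<open>\<epsilon> < 1\<close> opt_pos by simp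
  then have "Inv 0 s" using initially_ready[of \<epsilon> \<chi>] by (simp add: Inv_def s_def)
  have inner: "Inv (real (Suc a) * ?sum) (exec A ?inner t)" if "Inv (real a * ?sum) t" for a t
  proof -
    have "nval nN t = n" using that by (simp add: Inv_def ready_def input_def)
    have "Inv (real a * ?sum + ?sum) (exec A ?inner t)"
    proof (rule exec_For_invariant[where m = n and
          Inv = "\<lambda>g. Inv (real a * ?sum + (\<Sum>g\<in>{1..g}. ?T g))"], goal_cases)
      case 1
      show ?case by fact
    next
      case 2
      show ?case using that by (subst Inv_cong[of _ t]) simp_all
    next
      case (3 g u)
      let ?u = "tick 1 (nset ''g'' 0 (Suc g) u)"
      have "Inv (real a * ?sum + (\<Sum>g\<in>{1..g}. ?T g)) ?u"
        using 3(2) by (subst Inv_cong[of _ u]) auto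
      moreover have "0 \<le> real a * ?sum + (\<Sum>g\<in>{1..g}. ?T g)"
        using sum_nonneg[of n] sum_nonneg[of g] 3(1) by simp
      ultimately have "Inv (real a * ?sum + (\<Sum>g\<in>{1..g}. ?T g) + ?T (Suc g)) (exec A (try_guess N) ?u)"
        using 3(1) by (intro guess) auto
      then show ?case by (simp add: add.assoc)
    qed
    then show ?thesis by (simp add: algebra_simps)
  qed
  let ?final = "exec A (scheduler N L) (initial_store \<epsilon> \<chi> I)"
  have final: "?final = exec A (For ''a'' (NConst L) ?inner) s"
    by (simp add: scheduler_def s_def del: exec.simps(6))
  have "Inv (real L * ?sum) ?final"
    unfolding final
  proof (rule exec_For_invariant[where Inv = "\<lambda>a. Inv (real a * ?sum)"], goal_cases)
    case 2
    show ?case using \<open>Inv 0 s\<close> by (subst Inv_cong[of _ s]) simp_all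
  next
    case (3 a t)
    then show ?case by (intro inner) (subst Inv_cong[of _ t]; simp)
  qed simp
  \<comment> \<open>Each pass raises the guess by \<open>1 / N\<close> times the sum of the fastest
    running times, which is at least the optimum.\<close>
  moreover have "?lo * ?opt < real L * ?sum"
  proof -
    have "?lo * ?opt < real L / real N * ?opt" using large opt_pos by (rule mult_strict_right_mono)
    also have "\<dots> \<le> real L / real N * (\<Sum>g\<in>{1..n}. runtime I c g)"
      using opt_le_sum by (intro mult_left_mono) auto
    also have "\<dots> = real L * ?sum" by (simp flip: sum_divide_distrib)
    finally show ?thesis .
  qed
  ultimately have "ready I ?final" "rmem ?final ''best'' 0 0 \<le> (1 + \<epsilon> + \<epsilon> * hi) * ?opt"
    by (simp_all add: Inv_def)
  then show "is_schedule I S" "sched_makespan I S \<le> (1 + \<epsilon> + \<epsilon> * hi) * ?opt"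
    unfolding S_def computed_schedule_def by (auto simp: ready_def)
qed

end

section \<open>The constants and the final bound\<close>

theorem theorem2:
  fixes \<epsilon> \<chi> :: real
  assumes "0 < \<epsilon>" and "\<epsilon> < 1" and "0 < \<chi>" and "\<chi> < 1 - \<epsilon>"
  shows "\<exists>P d. \<forall>A. joint_approx_algorithm (1 + \<epsilon>) A \<longrightarrow>
           sched_approx_algorithm (1 + 2 * \<epsilon> + 2 * \<epsilon>\<^sup>2 / (1 - \<epsilon> - \<chi>)) (computed_schedule P A \<epsilon> \<chi>) \<and>
           (\<forall>I. ordered_sched_instance I \<longrightarrow>
              running_time P A \<epsilon> \<chi> I \<le> d * (machines I + num_jobs I + 1) ^ d)"
proof -
  \<comment> \<open>This is \<open>1 + 2 * \<epsilon> / (1 - \<epsilon> - \<chi>)\<close>, the value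
    for which \<open>1 + \<epsilon> + \<epsilon> * hi\<close> is the required ratio.\<close>
  define hi where "hi = (1 + \<epsilon> - \<chi>) / (1 - \<epsilon> - \<chi>)"
  let ?lo = "(1 + \<epsilon>) / (1 - \<epsilon>)" and ?\<rho> = "1 + 2 * \<epsilon> + 2 * \<epsilon>\<^sup>2 / (1 - \<epsilon> - \<chi>)"
  \<comment> \<open>As \<chi> is positive, the window has positive length, which leaves room for a
    fixed step \<open>1 / N\<close>.\<close>
  have "hi - ?lo = 2 * \<epsilon> * \<chi> / ((1 - \<epsilon> - \<chi>) * (1 - \<epsilon>))"
    using assms by (simp add: hi_def field_simps)
  also have "\<dots> > 0" using assms by simp
  finally obtain N where N: "0 < N" "1 / real N < hi - ?lo"
    using ex_inverse_of_nat_less[of "hi - ?lo"] by (auto simp: inverse_eq_divide)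
  obtain L :: nat where "?lo * real N < real L" using reals_Archimedean2 by blast
  then have L: "?lo < real L / real N" using N(1) by (simp add: pos_less_divide_eq)
  have \<rho>: "1 + \<epsilon> + \<epsilon> * hi = ?\<rho>"
    using assms by (simp add: hi_def field_simps power2_eq_square)
  obtain d where d: "\<And>A I. running_time (scheduler N L) A \<epsilon> \<chi> I \<le> d * (machines I + num_jobs I + 1) ^ d"
  proof -
    have "size_bounded (scheduler N L)" "''c'' \<notin> nwrites (scheduler N L)"
      "''n'' \<notin> nwrites (scheduler N L)"
      by (simp_all add: scheduler_defs)
    with running_time_poly that show ?thesis by blast
  qed
  have "is_schedule I (computed_schedule (scheduler N L) A \<epsilon> \<chi> I) \<and>
      sched_makespan I (computed_schedule (scheduler N L) A \<epsilon> \<chi> I) \<le> ?\<rho> * sched_opt I"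
    if "joint_approx_algorithm (1 + \<epsilon>) A" and I: "ordered_sched_instance I" for A I
  proof (cases "num_jobs I = 0")
    \<comment> \<open>Without jobs the optimum is 0, whereas \<open>scheduler\<close> relies on a
      positive optimum; here every assignment is a schedule of makespan 0.\<close>
    case True
    obtain S where "sched_makespan I S = sched_opt I"
      using sched_opt_attained[OF machines_ge_1[OF I]] by metis
    then show ?thesis using sched_makespan_no_jobs[OF I True] True by (simp add: is_schedule_def)
  next
    case False
    then show ?thesis
      using scheduler[OF I that(1), of N hi L \<chi>] assms N L by (simp add: \<rho>)
  qed
  with d show ?thesis
    by (intro exI[of _ "scheduler N L"] exI[of _ d]) (simp add: sched_approx_algorithm_def)
qed

end
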